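(* Let $\Bbbk$ be a field, let $H$ be a cocommutative Hopf algebra over $\Bbbk$, and let $M$ be a left $H$-module coalgebra. Then $M$ is amenable (as a Hopf-module coalgebra) if and only if $M$ is algebraically amenable as an ordinary left module over the associative algebra $H$.
   Context: A left $H$-module coalgebra is a coalgebra $M$ endowed with a left $H$-module structure such that the action map $H\otimes M\to M$ is a (counital) coalgebra map, i.e. $\Delta(hm)=\sum h_{(1)}m_{(1)}\otimes h_{(2)}m_{(2)}$ and $\varepsilon(hm)=\varepsilon(h)\varepsilon(m)$ for all $h\in H$, $m\in M$. For subspaces $F\le H$ and $E\le M$, $FE$ denotes the linear span of $\{fe: f\in F, e\in E\}$. $M$ is called amenable if for every finite-dimensional subspace $F\le H$ and every $\epsilon>0$ there exists a finite-dimensional subcoalgebra $E\le M$ with $\dim\frac{E+FE}{E}<\epsilon\dim E$ (the strict inequality forces $E\ne0$). A left module $M$ over an associative algebra $H$ is called algebraically amenable if for every finite-dimensional subspace $F\le H$ and every $\epsilon>0$ there exists a finite-dimensional subspace $E\le M$ with $\dim\frac{E+FE}{E}<\epsilon\dim E$. *)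

theory Defs
  imports Complex_Main "HOL-Library.Function_Algebras"
begin

section \<open>Tensor products of vector spaces\<close>

definition bilinear_map ::
  "('k::field \<Rightarrow> 'a::ab_group_add \<Rightarrow> 'a) \<Rightarrow> ('k \<Rightarrow> 'b::ab_group_add \<Rightarrow> 'b) \<Rightarrow>
   ('k \<Rightarrow> 'c::ab_group_add \<Rightarrow> 'c) \<Rightarrow> ('a \<Rightarrow> 'b \<Rightarrow> 'c) \<Rightarrow> bool" where
  "bilinear_map s1 s2 s3 B \<longleftrightarrow>
     (\<forall>a. Vector_Spaces.linear s2 s3 (\<lambda>b. B a b)) \<and>
     (\<forall>b. Vector_Spaces.linear s1 s3 (\<lambda>a. B a b))"

text \<open>The simple tensor of \<open>a\<close> and \<open>b\<close> is evaluation of bilinear forms at \<open>(a, b)\<close>, and the tensor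
  product is the span of the simple tensors inside the space of functionals on bilinear forms.
  Functionals are HOL functions on all maps \<open>'a \<Rightarrow> 'b \<Rightarrow> 'k\<close>, vanishing by convention on those that
  are not bilinear. As the scalar multiplications are locale parameters and not part of the types,
  the tensor product is a subspace of the type \<open>tensor\<close> and not the whole type. That it
  has the universal property of the tensor product is shown in \<open>tensor_universal\<close> below.\<close>

type_synonym ('a, 'b, 'k) tensor = "('a \<Rightarrow> 'b \<Rightarrow> 'k) \<Rightarrow> 'k"

definition tensor_scale :: "'k::field \<Rightarrow> ('a, 'b, 'k) tensor \<Rightarrow> ('a, 'b, 'k) tensor" where
  "tensor_scale c t = (\<lambda>\<beta>. c * t \<beta>)"

definition simple_tensor ::
  "('k::field \<Rightarrow> 'a::ab_group_add \<Rightarrow> 'a) \<Rightarrow> ('k \<Rightarrow> 'b::ab_group_add \<Rightarrow> 'b) \<Rightarrow>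
   'a \<Rightarrow> 'b \<Rightarrow> ('a, 'b, 'k) tensor" where
  "simple_tensor s1 s2 a b = (\<lambda>\<beta>. if bilinear_map s1 s2 (*) \<beta> then \<beta> a b else 0)"

text \<open>The image of \<open>A \<otimes> B\<close> in the tensor product of the ambient spaces.\<close>

definition tensor_span ::
  "('k::field \<Rightarrow> 'a::ab_group_add \<Rightarrow> 'a) \<Rightarrow> ('k \<Rightarrow> 'b::ab_group_add \<Rightarrow> 'b) \<Rightarrow>
   'a set \<Rightarrow> 'b set \<Rightarrow> ('a, 'b, 'k) tensor set" where
  "tensor_span s1 s2 A B =
     module.span tensor_scale {simple_tensor s1 s2 a b | a b. a \<in> A \<and> b \<in> B}"

abbreviation tensor_space ::
  "('k::field \<Rightarrow> 'a::ab_group_add \<Rightarrow> 'a) \<Rightarrow> ('k \<Rightarrow> 'b::ab_group_add \<Rightarrow> 'b) \<Rightarrow>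
   ('a, 'b, 'k) tensor set" where
  "tensor_space s1 s2 \<equiv> tensor_span s1 s2 UNIV UNIV"

text \<open>The linear map on the tensor product induced by a bilinear map. It is determined on
  \<open>tensor_space s1 s2\<close> only; its values elsewhere are irrelevant. The same applies to the other
  maps of tensors defined by choice below.\<close>

definition tensor_lift ::
  "('k::field \<Rightarrow> 'a::ab_group_add \<Rightarrow> 'a) \<Rightarrow> ('k \<Rightarrow> 'b::ab_group_add \<Rightarrow> 'b) \<Rightarrow>
   ('k \<Rightarrow> 'c::ab_group_add \<Rightarrow> 'c) \<Rightarrow> ('a \<Rightarrow> 'b \<Rightarrow> 'c) \<Rightarrow> ('a, 'b, 'k) tensor \<Rightarrow> 'c" where
  "tensor_lift s1 s2 s3 B =
     (SOME L. Vector_Spaces.linear tensor_scale s3 L \<and>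
        (\<forall>a b. L (simple_tensor s1 s2 a b) = B a b))"

text \<open>\<open>f \<otimes> g\<close>, for linear maps \<open>f\<close> and \<open>g\<close>.\<close>

definition tensor_map ::
  "('k::field \<Rightarrow> 'a::ab_group_add \<Rightarrow> 'a) \<Rightarrow> ('k \<Rightarrow> 'b::ab_group_add \<Rightarrow> 'b) \<Rightarrow>
   ('k \<Rightarrow> 'c::ab_group_add \<Rightarrow> 'c) \<Rightarrow> ('k \<Rightarrow> 'd::ab_group_add \<Rightarrow> 'd) \<Rightarrow>
   ('a \<Rightarrow> 'c) \<Rightarrow> ('b \<Rightarrow> 'd) \<Rightarrow> ('a, 'b, 'k) tensor \<Rightarrow> ('c, 'd, 'k) tensor" where
  "tensor_map s1 s2 s1' s2' f g =
     tensor_lift s1 s2 tensor_scale (\<lambda>a b. simple_tensor s1' s2' (f a) (g b))"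

definition tensor_swap ::
  "('k::field \<Rightarrow> 'a::ab_group_add \<Rightarrow> 'a) \<Rightarrow> ('k \<Rightarrow> 'b::ab_group_add \<Rightarrow> 'b) \<Rightarrow>
   ('a, 'b, 'k) tensor \<Rightarrow> ('b, 'a, 'k) tensor" where
  "tensor_swap s1 s2 = tensor_lift s1 s2 tensor_scale (\<lambda>a b. simple_tensor s2 s1 b a)"

definition tensor_assoc ::
  "('k::field \<Rightarrow> 'a::ab_group_add \<Rightarrow> 'a) \<Rightarrow> ('k \<Rightarrow> 'b::ab_group_add \<Rightarrow> 'b) \<Rightarrow>
   ('k \<Rightarrow> 'c::ab_group_add \<Rightarrow> 'c) \<Rightarrow>
   (('a, 'b, 'k) tensor, 'c, 'k) tensor \<Rightarrow> ('a, ('b, 'c, 'k) tensor, 'k) tensor" where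
  "tensor_assoc s1 s2 s3 =
     (SOME L. Vector_Spaces.linear tensor_scale tensor_scale L \<and>
        (\<forall>a b c. L (simple_tensor tensor_scale s3 (simple_tensor s1 s2 a b) c) =
                 simple_tensor s1 tensor_scale a (simple_tensor s2 s3 b c)))"

text \<open>For a bilinear map \<open>f\<close> from \<open>A \<times> B\<close> to \<open>B\<close>, the bilinear map from \<open>(A \<otimes> A) \<times> (B \<otimes> B)\<close> to
  \<open>B \<otimes> B\<close> which sends \<open>(a \<otimes> a', b \<otimes> b')\<close> to \<open>f a b \<otimes> f a' b'\<close>.\<close>

definition tensor_action ::
  "('k::field \<Rightarrow> 'a::ab_group_add \<Rightarrow> 'a) \<Rightarrow> ('k \<Rightarrow> 'b::ab_group_add \<Rightarrow> 'b) \<Rightarrow>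
   ('a \<Rightarrow> 'b \<Rightarrow> 'b) \<Rightarrow>
   ('a, 'a, 'k) tensor \<Rightarrow> ('b, 'b, 'k) tensor \<Rightarrow> ('b, 'b, 'k) tensor" where
  "tensor_action s1 s2 f =
     (SOME P. bilinear_map tensor_scale tensor_scale tensor_scale P \<and>
        (\<forall>a a' b b'. P (simple_tensor s1 s1 a a') (simple_tensor s2 s2 b b') =
                     simple_tensor s2 s2 (f a b) (f a' b')))"


subsection \<open>The chosen maps exist\<close>

lemma vector_space_tensor_scale:
  "vector_space (tensor_scale :: 'k::field \<Rightarrow> ('a, 'b, 'k) tensor \<Rightarrow> ('a, 'b, 'k) tensor)"
  by unfold_locales (auto simp: tensor_scale_def fun_eq_iff algebra_simps)

lemma vector_space_field: "vector_space ((*) :: 'k::field \<Rightarrow> 'k \<Rightarrow> 'k)"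
  by unfold_locales (auto simp: algebra_simps)

lemma linearI':
  assumes "vector_space s1" "vector_space s2"
    and "\<And>x y. f (x + y) = f x + f y" "\<And>c x. f (s1 c x) = s2 c (f x)"
  shows "Vector_Spaces.linear s1 s2 f"
  using assms by (auto simp: Vector_Spaces.linear_iff)

lemma linearD':
  assumes "Vector_Spaces.linear s1 s2 f"
  shows "vector_space s1" "vector_space s2"
    "f (x + y) = f x + f y" "f (s1 c x) = s2 c (f x)"
  using assms by (auto simp: Vector_Spaces.linear_iff)

lemma bilinear_mapD:
  assumes "bilinear_map s1 s2 s3 B"
  shows "vector_space s1" "vector_space s2" "vector_space s3"
    "B (a + a') b = B a b + B a' b" "B a (b + b') = B a b + B a b'"
    "B (s1 c a) b = s3 c (B a b)" "B a (s2 c b) = s3 c (B a b)"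
  using assms by (auto simp: bilinear_map_def Vector_Spaces.linear_iff)

lemma bilinear_mapI:
  assumes "vector_space s1" "vector_space s2" "vector_space s3"
    "\<And>a a' b. B (a + a') b = B a b + B a' b" "\<And>a b b'. B a (b + b') = B a b + B a b'"
    "\<And>c a b. B (s1 c a) b = s3 c (B a b)" "\<And>c a b. B a (s2 c b) = s3 c (B a b)"
  shows "bilinear_map s1 s2 s3 B"
  using assms by (auto simp: bilinear_map_def Vector_Spaces.linear_iff)

lemma bilinear_simple_tensor:
  assumes "vector_space s1" "vector_space s2"
  shows "bilinear_map s1 s2 tensor_scale (simple_tensor s1 s2)"
  using assms
  by (intro bilinear_mapI)
     (auto simp: vector_space_tensor_scale simple_tensor_def tensor_scale_def fun_eq_iff
        bilinear_mapD(4-7))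

lemma simple_tensor_in_tensor_space: "simple_tensor s1 s2 a b \<in> tensor_space s1 s2"
proof -
  interpret T: vector_space tensor_scale by (rule vector_space_tensor_scale)
  show ?thesis unfolding tensor_span_def by (rule T.span_base) blast
qed

lemma linear_functional_separates:
  fixes s :: "'k::field \<Rightarrow> 'a::ab_group_add \<Rightarrow> 'a"
  assumes "vector_space s" and "\<And>\<phi>. Vector_Spaces.linear s (*) \<phi> \<Longrightarrow> \<phi> x = \<phi> y"
  shows "x = y"
proof (rule ccontr)
  assume ne: "x \<noteq> y"
  interpret vector_space_pair s "(*) :: 'k \<Rightarrow> 'k \<Rightarrow> 'k"
    by (intro vector_space_pair.intro assms(1) vector_space_field)
  have ind: "vs1.independent {x - y}"
    using ne by (simp add: vs1.dependent_single)
  obtain \<phi> where \<phi>: "Vector_Spaces.linear s (*) \<phi>" "\<phi> (x - y) = 1"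
    using linear_independent_extend[OF ind, of "\<lambda>_. 1"] by auto
  then interpret L: Vector_Spaces.linear s "(*)" \<phi> by simp
  show False using assms(2)[OF \<phi>(1)] \<phi>(2) by (simp add: L.diff)
qed

theorem tensor_universal:
  fixes s1 :: "'k::field \<Rightarrow> 'a::ab_group_add \<Rightarrow> 'a" and s2 :: "'k \<Rightarrow> 'b::ab_group_add \<Rightarrow> 'b"
    and s3 :: "'k \<Rightarrow> 'c::ab_group_add \<Rightarrow> 'c"
  assumes B: "bilinear_map s1 s2 s3 B"
  shows "\<exists>L. Vector_Spaces.linear tensor_scale s3 L \<and>
           (\<forall>a b. L (simple_tensor s1 s2 a b) = B a b)"
    and "\<lbrakk>Vector_Spaces.linear tensor_scale s3 L; Vector_Spaces.linear tensor_scale s3 L';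
          \<And>a b. L (simple_tensor s1 s2 a b) = L' (simple_tensor s1 s2 a b);
          t \<in> tensor_space s1 s2\<rbrakk> \<Longrightarrow> L t = L' t"
proof -
  note vs = bilinear_mapD(1-3)[OF B]
  interpret vector_space_pair "tensor_scale :: 'k \<Rightarrow> ('a, 'b, 'k) tensor \<Rightarrow> _" s3
    by (intro vector_space_pair.intro vector_space_tensor_scale vs)
  let ?S = "{simple_tensor s1 s2 a b | a b. True}"
  show "L t = L' t" if "Vector_Spaces.linear tensor_scale s3 L"
    "Vector_Spaces.linear tensor_scale s3 L'"
    "\<And>a b. L (simple_tensor s1 s2 a b) = L' (simple_tensor s1 s2 a b)"
    "t \<in> tensor_space s1 s2"
  proof (rule linear_eq_on[OF that(1,2)])
    show "t \<in> vs1.span ?S" using that(4) by (simp add: tensor_span_def)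
    show "L x = L' x" if "x \<in> ?S" for x
      using that \<open>\<And>a b. L (simple_tensor s1 s2 a b) = L' (simple_tensor s1 s2 a b)\<close> by blast
  qed
  obtain C where C: "C \<subseteq> ?S" "vs1.independent C" "?S \<subseteq> vs1.span C"
    using vs1.maximal_independent_subset[of ?S] by blast
  define p where "p t = (SOME q. t = simple_tensor s1 s2 (fst q) (snd q))" for t
  have p: "t = simple_tensor s1 s2 (fst (p t)) (snd (p t))" if "t \<in> C" for t
    unfolding p_def by (rule someI_ex) (use that C(1) in auto)
  obtain L where L: "Vector_Spaces.linear tensor_scale s3 L"
    "\<And>t. t \<in> C \<Longrightarrow> L t = B (fst (p t)) (snd (p t))"
    using linear_independent_extend[OF C(2), of "\<lambda>t. B (fst (p t)) (snd (p t))"] by blast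
  have "L (simple_tensor s1 s2 a b) = B a b" for a b
  proof (rule linear_functional_separates[OF vs(3)])
    fix \<phi> :: "'c \<Rightarrow> 'k"
    assume \<phi>: "Vector_Spaces.linear s3 (*) \<phi>"
    have bil: "bilinear_map s1 s2 (*) (\<lambda>a b. \<phi> (B a b))"
      by (intro bilinear_mapI vs vector_space_field)
         (simp_all add: bilinear_mapD(4-7)[OF B] linearD'(3,4)[OF \<phi>])
    have lin1: "Vector_Spaces.linear tensor_scale (*) (\<lambda>t. \<phi> (L t))"
      by (intro linearI' vector_space_tensor_scale vector_space_field)
         (simp_all add: linearD'(3,4)[OF \<phi>] linearD'(3,4)[OF L(1)])
    have lin2: "Vector_Spaces.linear tensor_scale (*) (\<lambda>t::('a, 'b, 'k) tensor. t (\<lambda>a b. \<phi> (B a b)))"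
      by (intro linearI' vector_space_tensor_scale vector_space_field)
         (simp_all add: tensor_scale_def)
    interpret P: vector_space_pair "tensor_scale :: 'k \<Rightarrow> ('a, 'b, 'k) tensor \<Rightarrow> _"
      "(*) :: 'k \<Rightarrow> 'k \<Rightarrow> 'k"
      by (intro vector_space_pair.intro vector_space_tensor_scale vector_space_field)
    have on_C: "\<phi> (L t) = t (\<lambda>a b. \<phi> (B a b))" if "t \<in> C" for t
    proof -
      have "t (\<lambda>a b. \<phi> (B a b)) =
          simple_tensor s1 s2 (fst (p t)) (snd (p t)) (\<lambda>a b. \<phi> (B a b))"
        using p[OF that] by metis
      also have "\<dots> = \<phi> (L t)"
        using bil that by (simp add: simple_tensor_def L(2))
      finally show ?thesis by simp
    qed
    have "\<phi> (L t) = t (\<lambda>a b. \<phi> (B a b))" if "t \<in> vs1.span C" for t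
      by (rule P.linear_eq_on[OF lin1 lin2 that]) (rule on_C)
    then have "\<phi> (L (simple_tensor s1 s2 a b)) = simple_tensor s1 s2 a b (\<lambda>a b. \<phi> (B a b))"
      using C(3) by blast
    then show "\<phi> (L (simple_tensor s1 s2 a b)) = \<phi> (B a b)"
      using bil by (simp add: simple_tensor_def)
  qed
  with L(1) show "\<exists>L. Vector_Spaces.linear tensor_scale s3 L \<and>
           (\<forall>a b. L (simple_tensor s1 s2 a b) = B a b)" by blast
qed

lemma
  assumes "bilinear_map s1 s2 s3 B"
  shows linear_tensor_lift: "Vector_Spaces.linear tensor_scale s3 (tensor_lift s1 s2 s3 B)"
    and tensor_lift_simple: "tensor_lift s1 s2 s3 B (simple_tensor s1 s2 a b) = B a b"
  using someI_ex[OF tensor_universal(1)[OF assms]] unfolding tensor_lift_def by blast+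

lemma
  assumes "Vector_Spaces.linear s1 s1' f" "Vector_Spaces.linear s2 s2' g"
  shows linear_tensor_map:
      "Vector_Spaces.linear tensor_scale tensor_scale (tensor_map s1 s2 s1' s2' f g)"
    and tensor_map_simple: "tensor_map s1 s2 s1' s2' f g (simple_tensor s1 s2 a b) =
      simple_tensor s1' s2' (f a) (g b)"
proof -
  note f = linearD'[OF assms(1)] and g = linearD'[OF assms(2)]
  have "bilinear_map s1 s2 tensor_scale (\<lambda>a b. simple_tensor s1' s2' (f a) (g b))"
    using f g by (intro bilinear_mapI)
      (simp_all add: vector_space_tensor_scale bilinear_mapD(4-7)[OF bilinear_simple_tensor])
  then show "Vector_Spaces.linear tensor_scale tensor_scale (tensor_map s1 s2 s1' s2' f g)"
    "tensor_map s1 s2 s1' s2' f g (simple_tensor s1 s2 a b) = simple_tensor s1' s2' (f a) (g b)"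
    unfolding tensor_map_def by (auto simp: linear_tensor_lift tensor_lift_simple)
qed

lemma
  assumes "vector_space s1" "vector_space s2"
  shows linear_tensor_swap: "Vector_Spaces.linear tensor_scale tensor_scale (tensor_swap s1 s2)"
    and tensor_swap_simple: "tensor_swap s1 s2 (simple_tensor s1 s2 a b) = simple_tensor s2 s1 b a"
proof -
  have "bilinear_map s1 s2 tensor_scale (\<lambda>a b. simple_tensor s2 s1 b a)"
    using assms by (intro bilinear_mapI)
      (simp_all add: vector_space_tensor_scale bilinear_mapD(4-7)[OF bilinear_simple_tensor])
  then show "Vector_Spaces.linear tensor_scale tensor_scale (tensor_swap s1 s2)"
    "tensor_swap s1 s2 (simple_tensor s1 s2 a b) = simple_tensor s2 s1 b a"
    unfolding tensor_swap_def by (auto simp: linear_tensor_lift tensor_lift_simple)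
qed

lemma tensor_lift_unique:
  assumes "bilinear_map s1 s2 s3 B" "Vector_Spaces.linear tensor_scale s3 L"
    "\<And>a b. L (simple_tensor s1 s2 a b) = B a b" "t \<in> tensor_space s1 s2"
  shows "tensor_lift s1 s2 s3 B t = L t"
  by (rule tensor_universal(2)[OF assms(1) linear_tensor_lift[OF assms(1)] assms(2) _ assms(4)])
     (simp add: tensor_lift_simple[OF assms(1)] assms(3))

lemma tensor_lift_add_scale:
  assumes B: "bilinear_map s1 s2 s3 B" and B': "bilinear_map s1 s2 s3 B'"
    and t: "t \<in> tensor_space s1 s2"
  shows "tensor_lift s1 s2 s3 (\<lambda>a b. B a b + B' a b) t =
           tensor_lift s1 s2 s3 B t + tensor_lift s1 s2 s3 B' t"
    and "tensor_lift s1 s2 s3 (\<lambda>a b. s3 c (B a b)) t = s3 c (tensor_lift s1 s2 s3 B t)"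
proof -
  interpret vector_space s3 by (rule bilinear_mapD[OF B])
  note vs = bilinear_mapD(1-3)[OF B]
  note lin = linearD'(3,4)[OF linear_tensor_lift[OF B]] linearD'(3,4)[OF linear_tensor_lift[OF B']]
    and bil = bilinear_mapD(4-7)[OF B] bilinear_mapD(4-7)[OF B']
  show "tensor_lift s1 s2 s3 (\<lambda>a b. B a b + B' a b) t =
           tensor_lift s1 s2 s3 B t + tensor_lift s1 s2 s3 B' t"
    by (intro tensor_lift_unique[where L = "\<lambda>t. tensor_lift s1 s2 s3 B t + tensor_lift s1 s2 s3 B' t"]
          t bilinear_mapI linearI' vector_space_tensor_scale vs)
       (simp_all add: lin bil tensor_lift_simple[OF B] tensor_lift_simple[OF B']
         scale_right_distrib ac_simps)
  show "tensor_lift s1 s2 s3 (\<lambda>a b. s3 c (B a b)) t = s3 c (tensor_lift s1 s2 s3 B t)"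
    by (intro tensor_lift_unique[where L = "\<lambda>t. s3 c (tensor_lift s1 s2 s3 B t)"]
          t bilinear_mapI linearI' vector_space_tensor_scale vs)
       (simp_all add: lin bil tensor_lift_simple[OF B] tensor_lift_simple[OF B']
         scale_right_distrib ac_simps)
qed

lemma tensor_projection:
  fixes s1 :: "'k::field \<Rightarrow> 'a::ab_group_add \<Rightarrow> 'a" and s2 :: "'k \<Rightarrow> 'b::ab_group_add \<Rightarrow> 'b"
  obtains \<pi> where "Vector_Spaces.linear tensor_scale tensor_scale \<pi>"
    "\<And>t. \<pi> t \<in> tensor_space s1 s2" "\<And>t. t \<in> tensor_space s1 s2 \<Longrightarrow> \<pi> t = t"
proof -
  interpret vector_space_pair "tensor_scale :: 'k \<Rightarrow> ('a, 'b, 'k) tensor \<Rightarrow> _"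
      "tensor_scale :: 'k \<Rightarrow> ('a, 'b, 'k) tensor \<Rightarrow> _"
    by (intro vector_space_pair.intro vector_space_tensor_scale)
  have "vs1.subspace (tensor_space s1 s2)" by (simp add: tensor_span_def)
  from linear_exists_left_inverse_on[OF vs1.linear_id this] that show ?thesis
    by (auto simp: image_subset_iff)
qed

lemma tensor_assoc_exists:
  fixes s1 :: "'k::field \<Rightarrow> 'a::ab_group_add \<Rightarrow> 'a" and s2 :: "'k \<Rightarrow> 'b::ab_group_add \<Rightarrow> 'b"
    and s3 :: "'k \<Rightarrow> 'c::ab_group_add \<Rightarrow> 'c"
  assumes vs: "vector_space s1" "vector_space s2" "vector_space s3"
  shows "\<exists>L. Vector_Spaces.linear tensor_scale tensor_scale L \<and>
        (\<forall>a b c. L (simple_tensor tensor_scale s3 (simple_tensor s1 s2 a b) c) =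
                 simple_tensor s1 tensor_scale a (simple_tensor s2 s3 b c))"
proof -
  obtain \<pi> :: "('a, 'b, 'k) tensor \<Rightarrow> ('a, 'b, 'k) tensor"
    where \<pi>: "Vector_Spaces.linear tensor_scale tensor_scale \<pi>"
    "\<And>t. \<pi> t \<in> tensor_space s1 s2" "\<And>t. t \<in> tensor_space s1 s2 \<Longrightarrow> \<pi> t = t"
    by (rule tensor_projection[of s1 s2]) blast
  define Q where "Q c a b = simple_tensor s1 tensor_scale a (simple_tensor s2 s3 b c)" for a b c
  note bil1 = bilinear_mapD(4-7)[OF bilinear_simple_tensor[OF vs(2,3)]]
    and bil2 = bilinear_mapD(4-7)[OF bilinear_simple_tensor[OF vs(1) vector_space_tensor_scale]]
  have Q: "bilinear_map s1 s2 tensor_scale (Q c)" for c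
    by (intro bilinear_mapI vs vector_space_tensor_scale) (simp_all add: Q_def bil1 bil2)
  have Q_add: "Q (c + c') = (\<lambda>a b. Q c a b + Q c' a b)"
    and Q_scale: "Q (s3 r c) = (\<lambda>a b. tensor_scale r (Q c a b))" for c c' r
    by (simp_all add: Q_def bil1 bil2 fun_eq_iff)
  let ?G = "\<lambda>t c. tensor_lift s1 s2 tensor_scale (Q c) (\<pi> t)"
  have G: "bilinear_map tensor_scale s3 tensor_scale ?G"
    by (intro bilinear_mapI vs vector_space_tensor_scale)
       (simp_all add: linearD'(3,4)[OF \<pi>(1)] linearD'(3,4)[OF linear_tensor_lift[OF Q]]
          Q_add Q_scale tensor_lift_add_scale[OF Q Q] \<pi>(2))
  show ?thesis
    by (rule exI[of _ "tensor_lift tensor_scale s3 tensor_scale ?G"])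
       (simp add: linear_tensor_lift[OF G] tensor_lift_simple[OF G] \<pi>(3)
          simple_tensor_in_tensor_space tensor_lift_simple[OF Q], simp add: Q_def)
qed

lemma
  assumes "vector_space s1" "vector_space s2" "vector_space s3"
  shows linear_tensor_assoc:
      "Vector_Spaces.linear tensor_scale tensor_scale (tensor_assoc s1 s2 s3)"
    and tensor_assoc_simple:
      "tensor_assoc s1 s2 s3 (simple_tensor tensor_scale s3 (simple_tensor s1 s2 a b) c) =
         simple_tensor s1 tensor_scale a (simple_tensor s2 s3 b c)"
  using someI_ex[OF tensor_assoc_exists[OF assms]] unfolding tensor_assoc_def by blast+

lemma tensor_action_exists:
  fixes s1 :: "'k::field \<Rightarrow> 'a::ab_group_add \<Rightarrow> 'a" and s2 :: "'k \<Rightarrow> 'b::ab_group_add \<Rightarrow> 'b"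
  assumes f: "bilinear_map s1 s2 s2 f"
  shows "\<exists>P. bilinear_map tensor_scale tensor_scale tensor_scale P \<and>
        (\<forall>a a' b b'. P (simple_tensor s1 s1 a a') (simple_tensor s2 s2 b b') =
                     simple_tensor s2 s2 (f a b) (f a' b'))"
proof -
  note vs = bilinear_mapD(1,2)[OF f]
  obtain \<pi> :: "('a, 'a, 'k) tensor \<Rightarrow> ('a, 'a, 'k) tensor"
    where \<pi>: "Vector_Spaces.linear tensor_scale tensor_scale \<pi>"
    "\<And>t. \<pi> t \<in> tensor_space s1 s1" "\<And>t. t \<in> tensor_space s1 s1 \<Longrightarrow> \<pi> t = t"
    by (rule tensor_projection[of s1 s1]) blast
  obtain \<rho> :: "('b, 'b, 'k) tensor \<Rightarrow> ('b, 'b, 'k) tensor"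
    where \<rho>: "Vector_Spaces.linear tensor_scale tensor_scale \<rho>"
    "\<And>t. \<rho> t \<in> tensor_space s2 s2" "\<And>t. t \<in> tensor_space s2 s2 \<Longrightarrow> \<rho> t = t"
    by (rule tensor_projection[of s2 s2]) blast
  define Q where "Q a a' b b' = simple_tensor s2 s2 (f a b) (f a' b')" for a a' b b'
  note bf = bilinear_mapD(4-7)[OF f]
    and bs = bilinear_mapD(4-7)[OF bilinear_simple_tensor[OF vs(2,2)]]
  have Q: "bilinear_map s2 s2 tensor_scale (Q a a')" for a a'
    by (intro bilinear_mapI vs vector_space_tensor_scale) (simp_all add: Q_def bf bs)
  have Q_lin: "Q (a + c) a' = (\<lambda>b b'. Q a a' b b' + Q c a' b b')"
    "Q a (a' + c) = (\<lambda>b b'. Q a a' b b' + Q a c b b')"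
    "Q (s1 r a) a' = (\<lambda>b b'. tensor_scale r (Q a a' b b'))"
    "Q a (s1 r a') = (\<lambda>b b'. tensor_scale r (Q a a' b b'))" for a a' c r
    by (simp_all add: Q_def bf bs fun_eq_iff)
  define R where "R t a a' = tensor_lift s2 s2 tensor_scale (Q a a') (\<rho> t)" for t a a'
  have R: "bilinear_map s1 s1 tensor_scale (R t)" for t
    by (intro bilinear_mapI vs vector_space_tensor_scale)
       (simp_all add: R_def Q_lin tensor_lift_add_scale[OF Q Q] \<rho>(2))
  have R_lin: "R (t + t') = (\<lambda>a a'. R t a a' + R t' a a')"
    "R (tensor_scale r t) = (\<lambda>a a'. tensor_scale r (R t a a'))" for t t' r
    by (intro ext; simp add: R_def linearD'(3,4)[OF \<rho>(1)] linearD'(3,4)[OF linear_tensor_lift[OF Q]])+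
  let ?P = "\<lambda>s t. tensor_lift s1 s1 tensor_scale (R t) (\<pi> s)"
  have "bilinear_map tensor_scale tensor_scale tensor_scale ?P"
    by (intro bilinear_mapI vector_space_tensor_scale)
       (simp_all add: linearD'(3,4)[OF \<pi>(1)] linearD'(3,4)[OF linear_tensor_lift[OF R]]
          R_lin tensor_lift_add_scale[OF R R] \<pi>(2))
  moreover have "?P (simple_tensor s1 s1 a a') (simple_tensor s2 s2 b b') =
      simple_tensor s2 s2 (f a b) (f a' b')" for a a' b b'
    by (simp add: \<pi>(3) \<rho>(3) simple_tensor_in_tensor_space tensor_lift_simple[OF R])
       (simp add: R_def \<rho>(3) simple_tensor_in_tensor_space tensor_lift_simple[OF Q] Q_def)
  ultimately show ?thesis by (intro exI[of _ ?P]) blast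
qed

lemma
  assumes "bilinear_map s1 s2 s2 f"
  shows bilinear_tensor_action:
      "bilinear_map tensor_scale tensor_scale tensor_scale (tensor_action s1 s2 f)"
    and tensor_action_simple:
      "tensor_action s1 s2 f (simple_tensor s1 s1 a a') (simple_tensor s2 s2 b b') =
         simple_tensor s2 s2 (f a b) (f a' b')"
  using someI_ex[OF tensor_action_exists[OF assms]] unfolding tensor_action_def by blast+


section \<open>Coalgebras, Hopf algebras and module coalgebras\<close>

text \<open>Under the canonical isomorphisms \<open>\<kk> \<otimes> C \<cong> C \<cong> C \<otimes> \<kk>\<close>,
  the element \<open>c\<close> corresponds to \<open>1 \<otimes> c\<close> and \<open>c \<otimes> 1\<close>.\<close>

locale coalgebra = vector_space scale
  for scale :: "'k::field \<Rightarrow> 'c::ab_group_add \<Rightarrow> 'c" +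
  fixes comult :: "'c \<Rightarrow> ('c, 'c, 'k) tensor"
    and counit :: "'c \<Rightarrow> 'k"
  assumes comult_linear: "Vector_Spaces.linear scale tensor_scale comult"
    and comult_in: "comult c \<in> tensor_space scale scale"
    and counit_linear: "Vector_Spaces.linear scale (*) counit"
    and coassoc:
      "tensor_assoc scale scale scale
         (tensor_map scale scale tensor_scale scale comult id (comult c)) =
       tensor_map scale scale scale tensor_scale id comult (comult c)"
    and counit_left:
      "tensor_map scale scale (*) scale counit id (comult c) = simple_tensor (*) scale 1 c"
    and counit_right:
      "tensor_map scale scale scale (*) id counit (comult c) = simple_tensor scale (*) c 1"

locale assoc_algebra = vector_space scale
  for scale :: "'k::field \<Rightarrow> 'h::ring_1 \<Rightarrow> 'h" +
  assumes mult_bilinear: "bilinear_map scale scale scale (*)"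

locale bialgebra = assoc_algebra scale + coalgebra scale comult counit
  for scale :: "'k::field \<Rightarrow> 'h::ring_1 \<Rightarrow> 'h"
    and comult :: "'h \<Rightarrow> ('h, 'h, 'k) tensor"
    and counit :: "'h \<Rightarrow> 'k" +
  assumes comult_mult:
      "comult (x * y) = tensor_action scale scale (*) (comult x) (comult y)"
    and comult_one: "comult 1 = simple_tensor scale scale 1 1"
    and counit_mult: "counit (x * y) = counit x * counit y"
    and counit_one: "counit 1 = 1"

text \<open>The type class \<open>ring_1\<close> requires \<open>0 \<noteq> 1\<close>, which in a bialgebra follows from \<open>\<epsilon>(1) = 1\<close>.\<close>

locale hopf_algebra = bialgebra scale comult counit
  for scale :: "'k::field \<Rightarrow> 'h::ring_1 \<Rightarrow> 'h"
    and comult :: "'h \<Rightarrow> ('h, 'h, 'k) tensor"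
    and counit :: "'h \<Rightarrow> 'k" +
  fixes antipode :: "'h \<Rightarrow> 'h"
  assumes antipode_linear: "Vector_Spaces.linear scale scale antipode"
    and antipode_left:
      "tensor_lift scale scale scale (*)
         (tensor_map scale scale scale scale antipode id (comult h)) = scale (counit h) 1"
    and antipode_right:
      "tensor_lift scale scale scale (*)
         (tensor_map scale scale scale scale id antipode (comult h)) = scale (counit h) 1"

locale cocommutative_hopf_algebra = hopf_algebra +
  assumes cocommutative: "tensor_swap scale scale (comult h) = comult h"

locale left_module = H: assoc_algebra scaleH + M: vector_space scaleM
  for scaleH :: "'k::field \<Rightarrow> 'h::ring_1 \<Rightarrow> 'h"
    and scaleM :: "'k \<Rightarrow> 'm::ab_group_add \<Rightarrow> 'm" +
  fixes act :: "'h \<Rightarrow> 'm \<Rightarrow> 'm"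
  assumes act_bilinear: "bilinear_map scaleH scaleM scaleM act"
    and act_one: "act 1 m = m"
    and act_mult: "act (x * y) m = act x (act y m)"

locale module_coalgebra =
  H: bialgebra scaleH comultH counitH +
  M: coalgebra scaleM comultM counitM +
  left_module scaleH scaleM act
  for scaleH :: "'k::field \<Rightarrow> 'h::ring_1 \<Rightarrow> 'h"
    and comultH :: "'h \<Rightarrow> ('h, 'h, 'k) tensor"
    and counitH :: "'h \<Rightarrow> 'k"
    and scaleM :: "'k \<Rightarrow> 'm::ab_group_add \<Rightarrow> 'm"
    and comultM :: "'m \<Rightarrow> ('m, 'm, 'k) tensor"
    and counitM :: "'m \<Rightarrow> 'k"
    and act :: "'h \<Rightarrow> 'm \<Rightarrow> 'm" +
  assumes comult_act:
      "comultM (act h m) = tensor_action scaleH scaleM act (comultH h) (comultM m)"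
    and counit_act: "counitM (act h m) = counitH h * counitM m"

definition (in coalgebra) subcoalgebra :: "'c set \<Rightarrow> bool" where
  "subcoalgebra E \<longleftrightarrow> subspace E \<and> comult ` E \<subseteq> tensor_span scale scale E E"


section \<open>Amenability\<close>

definition fin_dim_subspace ::
  "('k::field \<Rightarrow> 'b::ab_group_add \<Rightarrow> 'b) \<Rightarrow> 'b set \<Rightarrow> bool" where
  "fin_dim_subspace s V \<longleftrightarrow> module.subspace s V \<and> (\<exists>B. finite B \<and> module.span s B = V)"

text \<open>The residue classes of the elements of \<open>B\<close> are pairwise distinct and form a basis of \<open>V / W\<close>.\<close>

definition quotient_basis ::
  "('k::field \<Rightarrow> 'b::ab_group_add \<Rightarrow> 'b) \<Rightarrow> 'b set \<Rightarrow> 'b set \<Rightarrow> 'b set \<Rightarrow> bool" where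
  "quotient_basis s V W B \<longleftrightarrow> B \<subseteq> V \<and>
     (\<forall>T u. finite T \<longrightarrow> T \<subseteq> B \<longrightarrow> (\<Sum>b\<in>T. s (u b) b) \<in> W \<longrightarrow> (\<forall>b\<in>T. u b = 0)) \<and>
     (\<forall>v\<in>V. \<exists>x\<in>module.span s B. v - x \<in> W)"

text \<open>The dimension of \<open>V / W\<close>, for \<open>W \<subseteq> V\<close> and \<open>V / W\<close> finite-dimensional.\<close>

definition quotient_dim ::
  "('k::field \<Rightarrow> 'b::ab_group_add \<Rightarrow> 'b) \<Rightarrow> 'b set \<Rightarrow> 'b set \<Rightarrow> nat" where
  "quotient_dim s V W = card (SOME B. quotient_basis s V W B)"

context vector_space
begin

lemma quotient_basis_card:
  assumes V: "fin_dim_subspace scale V" and W: "subspace W" "W \<subseteq> V" and B: "quotient_basis scale V W B"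
  shows "finite B" "card B + dim W = dim V"
proof -
  from V obtain G where G: "finite G" "span G = V" and sV: "subspace V"
    by (auto simp: fin_dim_subspace_def)
  have fin: "finite C" if "independent C" "C \<subseteq> V" for C
    using independent_span_bound[OF G(1) that(1)] that(2) G(2) by blast
  have B1: "B \<subseteq> V" and B2: "\<And>T u. finite T \<Longrightarrow> T \<subseteq> B \<Longrightarrow> (\<Sum>b\<in>T. scale (u b) b) \<in> W \<Longrightarrow> \<forall>b\<in>T. u b = 0"
    and B3: "\<And>v. v \<in> V \<Longrightarrow> \<exists>x\<in>span B. v - x \<in> W"
    using B unfolding quotient_basis_def by blast+
  obtain C where C: "C \<subseteq> W" "independent C" "W \<subseteq> span C" "card C = dim W"
    using basis_exists[of W] by blast
  have spC: "span C = W"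
    using C W by (metis span_minimal subset_antisym)
  have disj: "B \<inter> C = {}"
  proof (rule ccontr)
    assume "B \<inter> C \<noteq> {}"
    then obtain b where "b \<in> B" "b \<in> W" using C by blast
    with B2[of "{b}" "\<lambda>_. 1"] show False by simp
  qed
  have ind: "independent (B \<union> C)"
  proof
    assume "dependent (B \<union> C)"
    then obtain T u where T: "finite T" "T \<subseteq> B \<union> C" "(\<Sum>v\<in>T. scale (u v) v) = 0"
        "\<exists>v\<in>T. u v \<noteq> 0"
      unfolding dependent_explicit by blast
    have split: "(\<Sum>v\<in>T. scale (u v) v) =
        (\<Sum>v\<in>T \<inter> B. scale (u v) v) + (\<Sum>v\<in>T \<inter> C. scale (u v) v)"
      using T(1,2) disj by (subst sum.union_disjoint[symmetric]) (auto intro!: sum.cong)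
    have inW: "(\<Sum>v\<in>T \<inter> C. scale (u v) v) \<in> W"
      using C(1) W(1) by (intro subspace_sum subspace_scale) auto
    have "(\<Sum>v\<in>T \<inter> B. scale (u v) v) = - (\<Sum>v\<in>T \<inter> C. scale (u v) v)"
      using T(3) split by (simp add: eq_neg_iff_add_eq_0)
    then have "(\<Sum>v\<in>T \<inter> B. scale (u v) v) \<in> W"
      using inW W(1) by (simp add: subspace_neg)
    then have uB: "\<forall>v\<in>T \<inter> B. u v = 0"
      using B2[of "T \<inter> B" u] T(1) by simp
    then have "(\<Sum>v\<in>T \<inter> C. scale (u v) v) = 0"
      using T(3) split by (simp add: sum.neutral)
    then have "\<forall>v\<in>T \<inter> C. u v = 0"
      using independentD[OF C(2), of "T \<inter> C" u] T(1) by blast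
    with uB T show False by blast
  qed
  have "V \<subseteq> span (B \<union> C)"
  proof
    fix v assume "v \<in> V"
    then obtain x where "x \<in> span B" "v - x \<in> span C" using B3 spC by blast
    then have "x + (v - x) \<in> span (B \<union> C)"
      by (meson span_add span_mono sup_ge1 sup_ge2 subsetD)
    then show "v \<in> span (B \<union> C)" by simp
  qed
  moreover have sub: "B \<union> C \<subseteq> V" using B1 C(1) W(2) by blast
  ultimately have "card (B \<union> C) = dim V" by (intro basis_card_eq_dim ind)
  moreover have "finite (B \<union> C)" by (rule fin[OF ind sub])
  ultimately show "finite B" "card B + dim W = dim V"
    using disj C(4) by (simp_all add: card_Un_disjoint)
qed

lemma quotient_basis_exists:
  assumes V: "subspace V" and W: "subspace W" "W \<subseteq> V"
  shows "\<exists>B. quotient_basis scale V W B"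
proof -
  obtain C where C: "C \<subseteq> W" "independent C" "W \<subseteq> span C"
    using maximal_independent_subset[of W] by blast
  then have spC: "span C = W"
    using W by (metis span_minimal subset_antisym)
  obtain D where D: "C \<subseteq> D" "D \<subseteq> V" "independent D" "V \<subseteq> span D"
    using maximal_independent_subset_extend[of C V] C W by blast
  have "quotient_basis scale V W (D - C)"
    unfolding quotient_basis_def
  proof (intro conjI allI impI ballI)
    show "D - C \<subseteq> V" using D by blast
  next
    fix T u b
    assume T: "finite T" "T \<subseteq> D - C" "(\<Sum>b\<in>T. scale (u b) b) \<in> W" and b: "b \<in> T"
    then obtain S r where S: "finite S" "S \<subseteq> C"
        "(\<Sum>b\<in>T. scale (u b) b) = (\<Sum>a\<in>S. scale (r a) a)"
      unfolding spC[symmetric] span_explicit by auto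
    have dis: "S \<inter> T = {}" using S T by blast
    let ?q = "\<lambda>x. if x \<in> T then u x else - r x"
    have "(\<Sum>x\<in>S \<union> T. scale (?q x) x) = (\<Sum>x\<in>S. scale (- r x) x) + (\<Sum>x\<in>T. scale (u x) x)"
      using S(1) T(1) dis
      by (subst sum.union_disjoint) (auto intro!: arg_cong2[where f = "(+)"] sum.cong)
    also have "\<dots> = 0" using S(3) by (simp add: sum_negf)
    finally have zero: "(\<Sum>x\<in>S \<union> T. scale (?q x) x) = 0" .
    have "finite (S \<union> T)" "S \<union> T \<subseteq> D" "b \<in> S \<union> T" using S T b D(1) by auto
    then have "?q b = 0"
      using independentD[OF D(3) _ _ zero] by blast
    then show "u b = 0" using b by simp
  next
    fix v assume "v \<in> V"
    then have "v \<in> span ((D - C) \<union> C)" using D by (metis Diff_partition Un_commute subsetD)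
    then obtain x y where "v = x + y" "x \<in> span (D - C)" "y \<in> span C"
      unfolding span_Un by blast
    then show "\<exists>x\<in>span (D - C). v - x \<in> W" using spC by (intro bexI[of _ x]) auto
  qed
  then show ?thesis by blast
qed

lemma quotient_dim_eq:
  assumes "fin_dim_subspace scale V" "subspace W" "W \<subseteq> V"
  shows "quotient_dim scale V W = dim V - dim W"
proof -
  have "subspace V" using assms(1) by (simp add: fin_dim_subspace_def)
  then have "quotient_basis scale V W (SOME B. quotient_basis scale V W B)"
    by (rule someI_ex[OF quotient_basis_exists[OF _ assms(2,3)]])
  from quotient_basis_card(2)[OF assms this] show ?thesis
    unfolding quotient_dim_def by simp
qed

end

context left_module
begin

definition act_span :: "'h set \<Rightarrow> 'm set \<Rightarrow> 'm set" where
  "act_span F E = M.span {act f e | f e. f \<in> F \<and> e \<in> E}"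

definition almost_invariant :: "'h set \<Rightarrow> real \<Rightarrow> 'm set \<Rightarrow> bool" where
  "almost_invariant F \<epsilon> E \<longleftrightarrow>
     real (quotient_dim scaleM {x + y | x y. x \<in> E \<and> y \<in> act_span F E} E) < \<epsilon> * real (M.dim E)"

definition algebraically_amenable :: bool where
  "algebraically_amenable \<longleftrightarrow>
     (\<forall>F \<epsilon>. fin_dim_subspace scaleH F \<and> \<epsilon> > 0 \<longrightarrow>
        (\<exists>E. fin_dim_subspace scaleM E \<and> almost_invariant F \<epsilon> E))"

end

definition (in module_coalgebra) amenable :: bool where
  "amenable \<longleftrightarrow>
     (\<forall>F \<epsilon>. fin_dim_subspace scaleH F \<and> \<epsilon> > 0 \<longrightarrow>
        (\<exists>E. fin_dim_subspace scaleM E \<and> M.subcoalgebra E \<and> almost_invariant F \<epsilon> E))"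

end

theory Submission
  imports Defs
begin

text \<open>
  A finite-dimensional subspace \<open>E\<close> is replaced by subcoalgebras attached to it canonically: for \<open>l > 0\<close>
  let \<open>C\<^sub>l(E)\<close> be the largest subcoalgebra maximizing \<open>dim (E \<inter> C) - l dim C\<close>. It exists since the
  function is supermodular, and \<open>\<integral>\<^sub>0\<^sup>1 dim C\<^sub>l(E) dl = dim E\<close>. If \<open>F \<le> H\<close> is a finite-dimensional
  subcoalgebra and \<open>FE \<subseteq> E'\<close>, then \<open>F C\<^sub>l(E) \<subseteq> C\<^sub>l(E')\<close>; integrating, if \<open>E' = E + FE\<close> is only slightly
  larger than \<open>E\<close>, then for some \<open>l\<close> the subcoalgebra \<open>C\<^sub>l(E)\<close> is almost invariant under \<open>F\<close>.

  For the inclusion, view \<open>F\<close> as a group-like element over the algebra \<open>R = F\<^sup>*\<close>, which is commutative as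
  \<open>F\<close> is cocommutative: convolution \<open>u \<mapsto> (f \<mapsto> f\<^sub>(\<^sub>1\<^sub>) u(f\<^sub>(\<^sub>2\<^sub>)))\<close> is an automorphism of the \<open>R\<close>-coalgebra
  \<open>R \<otimes> M = Hom(F, M)\<close>, invertible by the antipode. It carries \<open>R \<otimes> C\<^sub>l(E)\<close>, the analogue of \<open>C\<^sub>l\<close> for
  \<open>R \<otimes> E\<close>, into that for \<open>R \<otimes> E'\<close>. Subcoalgebras are handled as the subspaces stable under the
  slices \<open>m \<mapsto> m\<^sub>(\<^sub>1\<^sub>) \<phi>(m\<^sub>(\<^sub>2\<^sub>))\<close> and \<open>m \<mapsto> \<phi>(m\<^sub>(\<^sub>1\<^sub>)) m\<^sub>(\<^sub>2\<^sub>)\<close> for functionals \<open>\<phi>\<close>.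
\<close>

section \<open>Finite-dimensional subspaces\<close>

context vector_space
begin

lemma fin_dim_subspaceD: "fin_dim_subspace scale V \<Longrightarrow> subspace V"
  by (simp add: fin_dim_subspace_def)

lemma fin_dim_subspace_span: "finite B \<Longrightarrow> fin_dim_subspace scale (span B)"
  by (auto simp: fin_dim_subspace_def)

lemma fin_dim_subspace_subset:
  assumes "fin_dim_subspace scale V" "subspace W" "W \<subseteq> V"
  shows "fin_dim_subspace scale W"
proof -
  from assms(1) obtain G where G: "finite G" "span G = V"
    by (auto simp: fin_dim_subspace_def)
  obtain B where B: "B \<subseteq> W" "independent B" "W \<subseteq> span B"
    using maximal_independent_subset by blast
  have "finite B"
    using independent_span_bound[OF G(1) B(2)] B(1) assms(3) G(2) by blast
  moreover have "span B = W"
    using B assms(2) by (metis span_minimal subset_antisym)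
  ultimately show ?thesis using assms(2) by (auto simp: fin_dim_subspace_def)
qed

lemma fin_dim_subspace_sums:
  assumes "fin_dim_subspace scale A" "fin_dim_subspace scale B"
  shows "fin_dim_subspace scale {x + y | x y. x \<in> A \<and> y \<in> B}"
proof -
  from assms obtain G G' where "finite G" "span G = A" "finite G'" "span G' = B"
    by (auto simp: fin_dim_subspace_def)
  then have "span (G \<union> G') = {x + y | x y. x \<in> A \<and> y \<in> B}"
    by (auto simp: span_Un)
  then show ?thesis
    using fin_dim_subspace_span[of "G \<union> G'"] \<open>finite G\<close> \<open>finite G'\<close> by simp
qed

lemma fin_dim_subspace_dim_mono:
  assumes "fin_dim_subspace scale V" "subspace W" "W \<subseteq> V"
  shows "dim W \<le> dim V"
  using quotient_basis_exists[OF fin_dim_subspaceD[OF assms(1)] assms(2,3)]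
    quotient_basis_card(2)[OF assms] by (metis le_add2)

lemma fin_dim_subspace_dim_eq:
  assumes "fin_dim_subspace scale V" "subspace W" "W \<subseteq> V" "dim V \<le> dim W"
  shows "W = V"
proof -
  obtain Q where Q: "quotient_basis scale V W Q"
    using quotient_basis_exists[OF fin_dim_subspaceD[OF assms(1)] assms(2,3)] by blast
  have "card Q = 0"
    using quotient_basis_card(2)[OF assms(1-3) Q] assms(4) by linarith
  then have "Q = {}"
    using quotient_basis_card(1)[OF assms(1-3) Q] by simp
  then have "V \<subseteq> W"
    using Q by (auto simp: quotient_basis_def)
  with assms(3) show ?thesis by blast
qed

text \<open>Second isomorphism theorem: a basis of \<open>A\<close> modulo
  \<open>A \<inter> B\<close> is also a basis of \<open>A + B\<close> modulo
  \<open>B\<close>.\<close>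

lemma dim_sums_Int_fin_dim:
  assumes A: "fin_dim_subspace scale A" and B: "fin_dim_subspace scale B"
  shows "dim {x + y | x y. x \<in> A \<and> y \<in> B} + dim (A \<inter> B) = dim A + dim B"
    (is "dim ?S + _ = _")
proof -
  note sA = fin_dim_subspaceD[OF A] and sB = fin_dim_subspaceD[OF B]
  have sI: "subspace (A \<inter> B)" using sA sB by (rule subspace_inter)
  obtain Q where Q: "quotient_basis scale A (A \<inter> B) Q"
    using quotient_basis_exists[OF sA sI] by blast
  have sub: "B \<subseteq> ?S" using subspace_0[OF sA] by force
  have "quotient_basis scale ?S B Q"
    unfolding quotient_basis_def
  proof (intro conjI allI impI)
    show "Q \<subseteq> ?S"
      using Q subspace_0[OF sB] unfolding quotient_basis_def by force
  next
    fix T u assume T: "finite T" "T \<subseteq> Q" "(\<Sum>b\<in>T. scale (u b) b) \<in> B"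
    have "(\<Sum>b\<in>T. scale (u b) b) \<in> A"
      using T Q sA unfolding quotient_basis_def by (intro subspace_sum subspace_scale) auto
    with T Q show "\<forall>b\<in>T. u b = 0" unfolding quotient_basis_def by blast
  next
    show "\<forall>v\<in>?S. \<exists>x\<in>span Q. v - x \<in> B"
    proof
      fix v assume "v \<in> ?S"
      then obtain a b where ab: "v = a + b" "a \<in> A" "b \<in> B" by blast
      then obtain x where x: "x \<in> span Q" "a - x \<in> B"
        using Q unfolding quotient_basis_def by blast
      have "v - x = (a - x) + b" using ab by simp
      then have "v - x \<in> B" using x ab sB by (simp only: subspace_add)
      with x show "\<exists>x\<in>span Q. v - x \<in> B" by blast
    qed
  qed
  from quotient_basis_card(2)[OF fin_dim_subspace_sums[OF A B] sB sub this]
    quotient_basis_card(2)[OF A sI _ Q]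
  show ?thesis by simp
qed

text \<open>A basis \<open>Q\<close> of \<open>V\<close> modulo the kernel is mapped injectively
  onto a basis of the image.\<close>

lemma rank_nullity:
  assumes f: "Vector_Spaces.linear scale s f" and V: "fin_dim_subspace scale V"
  shows "fin_dim_subspace s (f ` V)"
    and "dim V = vector_space.dim s (f ` V) + dim {v \<in> V. f v = 0}"
proof -
  interpret f: Vector_Spaces.linear scale s f by (rule f)
  note sV = fin_dim_subspaceD[OF V]
  from V obtain G where "finite G" "span G = V" by (auto simp: fin_dim_subspace_def)
  then show fin: "fin_dim_subspace s (f ` V)"
    using f.vs2.fin_dim_subspace_span[of "f ` G"] by (simp add: f.span_image)
  let ?K = "{v \<in> V. f v = 0}"
  have sK: "subspace ?K" "?K \<subseteq> V"
    using sV by (auto intro!: subspaceI simp: subspace_0 subspace_add subspace_scale f.add f.scale)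
  obtain Q where Q: "quotient_basis scale V ?K Q"
    using quotient_basis_exists[OF sV sK] by blast
  note cardQ = quotient_basis_card[OF V sK Q]
  have Q1: "Q \<subseteq> V" and Q2: "\<And>u. (\<Sum>b\<in>Q. scale (u b) b) \<in> ?K \<Longrightarrow> \<forall>b\<in>Q. u b = 0"
    and Q3: "\<And>v. v \<in> V \<Longrightarrow> \<exists>x\<in>span Q. v - x \<in> ?K"
    using Q cardQ(1) unfolding quotient_basis_def by blast+
  have inj: "inj_on f Q"
  proof
    fix x y assume xy: "x \<in> Q" "y \<in> Q" "f x = f y"
    show "x = y"
    proof (rule ccontr)
      assume ne: "x \<noteq> y"
      \<comment> \<open>The coefficients of \<open>x - y\<close>; this difference lies in the
        kernel, against the independence of \<open>Q\<close> modulo the kernel.\<close>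
      let ?u = "\<lambda>b. if b = x then 1 :: 'a else if b = y then - 1 else 0"
      have "(\<Sum>b\<in>Q. scale (?u b) b) = (\<Sum>b\<in>{x, y}. scale (?u b) b)"
        using xy cardQ(1) by (intro sum.mono_neutral_right) auto
      also have "\<dots> = x - y" using ne by simp
      also have "\<dots> \<in> ?K" using xy Q1 subspace_diff[OF sV, of x y] by (auto simp: f.diff)
      finally have "\<forall>b\<in>Q. ?u b = 0" by (rule Q2)
      from this xy(1) have "?u x = 0" by (rule bspec)
      then show False by simp
    qed
  qed
  have ind: "f.vs2.independent (f ` Q)"
  proof (rule f.vs2.independent_if_scalars_zero)
    show "finite (f ` Q)" using cardQ by simp
    fix w y assume w: "(\<Sum>y\<in>f ` Q. s (w y) y) = 0" and y: "y \<in> f ` Q"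
    have "f (\<Sum>b\<in>Q. scale (w (f b)) b) = (\<Sum>y\<in>f ` Q. s (w y) y)"
      by (simp add: f.sum f.scale sum.reindex[OF inj])
    then have "f (\<Sum>b\<in>Q. scale (w (f b)) b) = 0" using w by (rule trans)
    moreover have "(\<Sum>b\<in>Q. scale (w (f b)) b) \<in> V"
      using Q1 sV by (intro subspace_sum subspace_scale) auto
    ultimately have "(\<Sum>b\<in>Q. scale (w (f b)) b) \<in> ?K" by (intro CollectI conjI)
    then have "\<forall>b\<in>Q. w (f b) = 0" by (rule Q2)
    with y show "w y = 0" by blast
  qed
  have sp: "f ` V \<subseteq> f.vs2.span (f ` Q)"
  proof
    fix y assume "y \<in> f ` V"
    then obtain v where v: "v \<in> V" "y = f v" by blast
    then obtain x where x: "x \<in> span Q" "v - x \<in> ?K" using Q3 by blast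
    then have "f v = f x" by (simp add: f.diff)
    with x v show "y \<in> f.vs2.span (f ` Q)" by (auto simp: f.span_image)
  qed
  have "card (f ` Q) = f.vs2.dim (f ` V)"
    using Q1 by (intro f.vs2.basis_card_eq_dim sp ind) auto
  then show "dim V = vector_space.dim s (f ` V) + dim ?K"
    using cardQ by (simp add: card_image[OF inj])
qed

lemma dim_zero_subspace: "dim {0} = 0"
  by (rule dim_unique[of "{}"]) (auto simp: independent_empty)

lemma dim_linear_image_inj_on:
  assumes f: "Vector_Spaces.linear scale s f" and V: "fin_dim_subspace scale V"
    and inj: "\<And>v. v \<in> V \<Longrightarrow> f v = 0 \<Longrightarrow> v = 0"
  shows "vector_space.dim s (f ` V) = dim V"
proof -
  interpret f: Vector_Spaces.linear scale s f by (rule f)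
  have "{v \<in> V. f v = 0} = {0}"
    using inj subspace_0[OF fin_dim_subspaceD[OF V]] by auto
  then show ?thesis using rank_nullity(2)[OF f V] by (simp add: dim_zero_subspace)
qed

end

section \<open>Destabilizing subspaces\<close>

definition fun_scale :: "('k \<Rightarrow> 'b \<Rightarrow> 'b) \<Rightarrow> 'k \<Rightarrow> ('i \<Rightarrow> 'b) \<Rightarrow> 'i \<Rightarrow> 'b" where
  "fun_scale s c u = (\<lambda>i. s c (u i))"

text \<open>Families indexed by \<open>I\<close>, realized as functions vanishing off
  \<open>I\<close>. For finite \<open>I\<close> and finite-dimensional \<open>X\<close> they form a
  subspace of the function type of dimension \<open>card I * dim X\<close>.\<close>

definition tuples :: "'i set \<Rightarrow> 'b set \<Rightarrow> ('i \<Rightarrow> 'b::zero) set" where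
  "tuples I X = {u. (\<forall>i\<in>I. u i \<in> X) \<and> (\<forall>i. i \<notin> I \<longrightarrow> u i = 0)}"

lemma fun_scale_apply: "fun_scale s c u i = s c (u i)"
  by (simp add: fun_scale_def)

lemma vector_space_fun_scale: "vector_space s \<Longrightarrow> vector_space (fun_scale s)"
  by (simp add: vector_space_def fun_scale_def fun_eq_iff)

text \<open>When \<open>ops\<close> are the slices of a coalgebra, stable subspaces are
  finite-dimensional subcoalgebras. Keeping \<open>ops\<close> abstract lets the same notions serve
  for spaces of tuples.\<close>

locale operator_space = vector_space scale
  for scale :: "'k::field \<Rightarrow> 'b::ab_group_add \<Rightarrow> 'b" +
  fixes ops :: "('b \<Rightarrow> 'b) set"
  assumes ops_linear: "T \<in> ops \<Longrightarrow> Vector_Spaces.linear scale scale T"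
begin

lemma ops_zero: "T \<in> ops \<Longrightarrow> T 0 = 0"
  using linearD'(3)[OF ops_linear, of T 0 0] by simp

definition stable :: "'b set \<Rightarrow> bool" where
  "stable X \<longleftrightarrow> fin_dim_subspace scale X \<and> (\<forall>T\<in>ops. T ` X \<subseteq> X)"

definition excess :: "real \<Rightarrow> 'b set \<Rightarrow> 'b set \<Rightarrow> real" where
  "excess l E X = real (dim (E \<inter> X)) - l * real (dim X)"

text \<open>The largest maximizer of \<open>excess l E\<close>, in the manner of the maximal
  destabilizing subobject of Harder-Narasimhan theory. As it contains every other maximizer, it is
  determined by \<open>l\<close> and \<open>E\<close>.\<close>

definition destabilizing :: "real \<Rightarrow> 'b set \<Rightarrow> 'b set \<Rightarrow> bool" where
  "destabilizing l E C \<longleftrightarrow> stable C \<and>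
     (\<forall>D. stable D \<longrightarrow> excess l E D \<le> excess l E C \<and> (excess l E D = excess l E C \<longrightarrow> D \<subseteq> C))"

lemma stable_fin_dim: "stable X \<Longrightarrow> fin_dim_subspace scale X"
  by (simp add: stable_def)

lemma stable_subspace: "stable X \<Longrightarrow> subspace X"
  by (simp add: stable_def fin_dim_subspace_def)

lemma stableD: "stable X \<Longrightarrow> T \<in> ops \<Longrightarrow> x \<in> X \<Longrightarrow> T x \<in> X"
  by (auto simp: stable_def)

lemma stable_sums:
  assumes "stable C" "stable D"
  shows "stable {x + y | x y. x \<in> C \<and> y \<in> D}"
  unfolding stable_def
proof (intro conjI ballI)
  show "fin_dim_subspace scale {x + y | x y. x \<in> C \<and> y \<in> D}"
    using assms by (intro fin_dim_subspace_sums stable_fin_dim)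
  fix T assume T: "T \<in> ops"
  then show "T ` {x + y | x y. x \<in> C \<and> y \<in> D} \<subseteq> {x + y | x y. x \<in> C \<and> y \<in> D}"
    using stableD[OF assms(1) T] stableD[OF assms(2) T]
    by (fastforce simp: linearD'(3)[OF ops_linear[OF T]])
qed

lemma stable_zero: "stable {0}"
  using fin_dim_subspace_span[of "{}"] by (auto simp: stable_def ops_zero)

lemma excess_zero: "subspace E \<Longrightarrow> excess l E {0} = 0"
  using subspace_0 by (simp add: excess_def dim_zero_subspace Int_absorb1)

text \<open>\<open>dim X\<close> is modular in \<open>X\<close>, whereas the sum of
  \<open>E \<inter> C\<close> and \<open>E \<inter> D\<close> is only contained in the intersection
  of \<open>E\<close> with \<open>C + D\<close>, so the first term of the excess can only
  gain.\<close>

lemma excess_supermodular: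
  assumes "fin_dim_subspace scale E" "stable C" "stable D"
  shows "excess l E C + excess l E D \<le>
    excess l E {x + y | x y. x \<in> C \<and> y \<in> D} + excess l E (C \<inter> D)"
proof -
  let ?S = "{x + y | x y. x \<in> C \<and> y \<in> D}"
  note sE = fin_dim_subspaceD[OF assms(1)]
  note sC = stable_subspace[OF assms(2)] and sD = stable_subspace[OF assms(3)]
  have fC: "fin_dim_subspace scale (E \<inter> C)" and fD: "fin_dim_subspace scale (E \<inter> D)"
    and fS: "fin_dim_subspace scale (E \<inter> ?S)"
    using assms(1) sE sC sD
    by (auto intro!: fin_dim_subspace_subset[OF assms(1)] subspace_inter subspace_sums)
  have "dim {x + y | x y. x \<in> E \<inter> C \<and> y \<in> E \<inter> D} \<le> dim (E \<inter> ?S)"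
    using sE fC fD
    by (intro fin_dim_subspace_dim_mono fS subspace_sums fin_dim_subspaceD)
       (auto simp: subspace_add)
  with dim_sums_Int_fin_dim[OF fC fD]
  have 1: "dim (E \<inter> C) + dim (E \<inter> D) \<le> dim (E \<inter> ?S) + dim (E \<inter> (C \<inter> D))"
    by (simp add: Int_ac)
  have 2: "real (dim ?S) + real (dim (C \<inter> D)) = real (dim C) + real (dim D)"
    using dim_sums_Int_fin_dim[OF stable_fin_dim[OF assms(2)] stable_fin_dim[OF assms(3)]]
    by linarith
  have "l * real (dim ?S) + l * real (dim (C \<inter> D)) = l * real (dim C) + l * real (dim D)"
    using arg_cong[OF 2, of "\<lambda>x. l * x"] by (simp only: distrib_left)
  with 1 show ?thesis unfolding excess_def by linarith
qed

lemma stable_Int: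
  assumes "stable C" "stable D"
  shows "stable (C \<inter> D)"
proof -
  have "fin_dim_subspace scale (C \<inter> D)"
    using assms by (intro fin_dim_subspace_subset[OF stable_fin_dim[OF assms(1)]] subspace_inter)
      (auto simp: stable_subspace)
  then show ?thesis using stableD[OF assms(1)] stableD[OF assms(2)] by (auto simp: stable_def)
qed

text \<open>Since \<open>{0}\<close> has excess 0, only stable subspaces of nonnegative excess
  compete. Their dimension is at most \<open>dim E / l\<close>, so the excess takes finitely many
  values on them. By supermodularity the sum of two maximizers is a maximizer, so a maximizer of
  largest dimension contains all others.\<close>

lemma destabilizing_exists:
  assumes E: "fin_dim_subspace scale E" and l: "0 < l"
  shows "\<exists>C. destabilizing l E C"
proof -
  define S where "S = {C. stable C \<and> 0 \<le> excess l E C}"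
  define n where "n = nat \<lceil>real (dim E) / l\<rceil>"
  note sE = fin_dim_subspaceD[OF E]
  have zero: "{0} \<in> S"
    by (simp add: S_def stable_zero excess_zero[OF sE])
  have bound: "dim (E \<inter> C) \<le> dim E \<and> dim C \<le> n" if "C \<in> S" for C
  proof
    have C: "stable C" "0 \<le> excess l E C" using that by (auto simp: S_def)
    show le: "dim (E \<inter> C) \<le> dim E"
      using sE stable_subspace[OF C(1)] by (intro fin_dim_subspace_dim_mono[OF E] subspace_inter) auto
    have "l * real (dim C) \<le> real (dim E)"
      using C(2) le unfolding excess_def by linarith
    then have "real (dim C) \<le> real (dim E) / l"
      using l by (simp add: field_simps)
    then show "dim C \<le> n" unfolding n_def by linarith
  qed
  have fin1: "finite (excess l E ` S)"
  proof (rule finite_subset)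
    show "excess l E ` S \<subseteq> (\<lambda>(a, b). real a - l * real b) ` ({..dim E} \<times> {..n})"
    proof
      fix v assume "v \<in> excess l E ` S"
      then obtain C where C: "C \<in> S" "v = real (dim (E \<inter> C)) - l * real (dim C)"
        by (auto simp: excess_def)
      with bound[OF C(1)] show "v \<in> (\<lambda>(a, b). real a - l * real b) ` ({..dim E} \<times> {..n})"
        by (intro image_eqI[of _ _ "(dim (E \<inter> C), dim C)"]) auto
    qed
  qed simp
  define m where "m = Max (excess l E ` S)"
  define S' where "S' = {C \<in> S. excess l E C = m}"
  have "m \<in> excess l E ` S"
    unfolding m_def using zero by (intro Max_in fin1) auto
  then have ne: "S' \<noteq> {}" by (auto simp: S'_def)
  have "dim ` S' \<subseteq> {..n}" using bound by (auto simp: S'_def)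
  then have fin2: "finite (dim ` S')" by (rule finite_subset) simp
  have "Max (dim ` S') \<in> dim ` S'" using ne by (intro Max_in fin2) auto
  then obtain C where C: "C \<in> S'" "dim C = Max (dim ` S')" by auto
  have max_dim: "dim D \<le> dim C" if "D \<in> S'" for D
    unfolding C(2) using that by (intro Max_ge fin2) auto
  have C': "stable C" "excess l E C = m" "0 \<le> excess l E C" using C(1) by (auto simp: S'_def S_def)
  have max_excess: "excess l E D \<le> excess l E C" if "stable D" for D
  proof (cases "D \<in> S")
    case True
    then show ?thesis unfolding C'(2) m_def by (intro Max_ge fin1) auto
  next
    case False
    then show ?thesis using that C'(3) by (auto simp: S_def)
  qed
  have "D \<subseteq> C" if D: "stable D" "excess l E D = excess l E C" for D
  proof -
    let ?S = "{x + y | x y. x \<in> C \<and> y \<in> D}"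
    have sS: "stable ?S" by (rule stable_sums[OF C'(1) D(1)])
    have "excess l E ?S \<ge> excess l E C"
      using excess_supermodular[OF E C'(1) D(1), of l] max_excess[OF stable_Int[OF C'(1) D(1)]] D(2)
      by linarith
    with max_excess[OF sS] have eq: "excess l E ?S = excess l E C" by linarith
    then have "?S \<in> S'" using sS C' by (simp add: S'_def S_def)
    note le = max_dim[OF this]
    have "C \<subseteq> ?S" using subspace_0[OF stable_subspace[OF D(1)]] by force
    then have "C = ?S"
      using le by (intro fin_dim_subspace_dim_eq stable_fin_dim stable_subspace sS C'(1)) auto
    moreover have "D \<subseteq> ?S" using subspace_0[OF stable_subspace[OF C'(1)]] by force
    ultimately show ?thesis by simp
  qed
  with C'(1) max_excess show ?thesis unfolding destabilizing_def by blast
qed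

lemma destabilizing_stable: "destabilizing l E C \<Longrightarrow> stable C"
  by (simp add: destabilizing_def)

lemma destabilizing_max: "destabilizing l E C \<Longrightarrow> stable D \<Longrightarrow> excess l E D \<le> excess l E C"
  by (simp add: destabilizing_def)

end

section \<open>Tuples\<close>

locale operator_tuples = operator_space scale ops
  for scale :: "'k::field \<Rightarrow> 'b::ab_group_add \<Rightarrow> 'b" and ops :: "('b \<Rightarrow> 'b) set" +
  fixes index :: "'i set"
  assumes finite_index: "finite index"
begin

text \<open>Operators act on tuples entry by entry; the prefix \<open>T\<close> then supplies
  stability, excess and dimension for spaces of tuples.\<close>

sublocale T: operator_space "fun_scale scale :: 'k \<Rightarrow> ('i \<Rightarrow> 'b) \<Rightarrow> 'i \<Rightarrow> 'b"
  "(\<lambda>T u. T \<circ> u) ` ops"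
proof (intro operator_space.intro operator_space_axioms.intro)
  show vs: "vector_space (fun_scale scale :: 'k \<Rightarrow> ('i \<Rightarrow> 'b) \<Rightarrow> 'i \<Rightarrow> 'b)"
    by (intro vector_space_fun_scale vector_space_axioms)
  fix T' :: "('i \<Rightarrow> 'b) \<Rightarrow> 'i \<Rightarrow> 'b"
  assume "T' \<in> (\<lambda>T u. T \<circ> u) ` ops"
  then obtain T where T: "T \<in> ops" "T' = (\<lambda>u. T \<circ> u)" by blast
  show "Vector_Spaces.linear (fun_scale scale) (fun_scale scale) T'"
    by (intro linearI' vs)
      (simp_all add: T(2) fun_eq_iff fun_scale_def linearD'(3,4)[OF ops_linear[OF T(1)]])
qed

lemma linear_coordinate: "Vector_Spaces.linear (fun_scale scale) scale (\<lambda>u. u (i :: 'i))"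
  by (intro linearI' T.vector_space_axioms vector_space_axioms) (simp_all add: fun_scale_def)

lemma subspace_tuples: "subspace X \<Longrightarrow> T.subspace (tuples J X)"
  by (rule T.subspaceI)
    (auto simp: tuples_def fun_scale_def subspace_0 subspace_add subspace_scale)

text \<open>Together with \<open>tuples_insert_image\<close> this gives the kernel and image of the
  coordinate at \<open>i\<close>, as needed for counting dimensions by rank-nullity, one index at a
  time.\<close>

lemma tuples_insert_kernel:
  assumes "i \<notin> J" "subspace X"
  shows "{u \<in> tuples (insert i J) X. u i = 0} = tuples J X"
  using assms(1) subspace_0[OF assms(2)] by (auto simp: tuples_def)

lemma tuples_insert_image:
  assumes "subspace X"
  shows "(\<lambda>u. u i) ` tuples (insert i J) X = X"
proof
  show "X \<subseteq> (\<lambda>u. u i) ` tuples (insert i J) X"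
  proof
    fix x assume "x \<in> X"
    then show "x \<in> (\<lambda>u. u i) ` tuples (insert i J) X"
      using subspace_0[OF assms]
      by (intro image_eqI[of _ _ "\<lambda>j. if j = i then x else 0"]) (auto simp: tuples_def)
  qed
qed (auto simp: tuples_def)

lemma tuples_dim:
  assumes "finite J" and X: "fin_dim_subspace scale X"
  shows "fin_dim_subspace (fun_scale scale) (tuples J X)" "T.dim (tuples J X) = card J * dim X"
  using assms(1)
proof (induction J)
  case empty
  have "tuples ({} :: 'i set) X = {0}" by (auto simp: tuples_def fun_eq_iff)
  then show "fin_dim_subspace (fun_scale scale) (tuples ({} :: 'i set) X)"
    "T.dim (tuples ({} :: 'i set) X) = card ({} :: 'i set) * dim X"
    using T.stable_fin_dim[OF T.stable_zero] T.dim_zero_subspace by simp_all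
next
  case (insert i J)
  note sX = fin_dim_subspaceD[OF X]
  \<comment> \<open>The tuple whose only possibly nonzero entry is \<open>x\<close> at
    \<open>i\<close>. Adding such tuples to \<open>tuples J X\<close> gives finite dimension, which
    rank-nullity needs before it can count.\<close>
  define e where "e x = (\<lambda>j. if j = i then x else 0)" for x :: 'b
  have lin: "Vector_Spaces.linear scale (fun_scale scale) e"
    by (intro linearI' T.vector_space_axioms vector_space_axioms)
      (simp_all add: e_def fun_scale_def fun_eq_iff)
  have sub: "tuples (insert i J) X \<subseteq> {u + v | u v. u \<in> e ` X \<and> v \<in> tuples J X}"
  proof
    fix u assume u: "u \<in> tuples (insert i J) X"
    have "u = e (u i) + u(i := 0)" by (auto simp: e_def fun_eq_iff)
    moreover have "u i \<in> X" "u(i := 0) \<in> tuples J X"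
      using u insert.hyps by (auto simp: tuples_def)
    ultimately show "u \<in> {u + v | u v. u \<in> e ` X \<and> v \<in> tuples J X}" by blast
  qed
  show fin: "fin_dim_subspace (fun_scale scale) (tuples (insert i J) X)"
    by (rule T.fin_dim_subspace_subset[OF T.fin_dim_subspace_sums[OF rank_nullity(1)[OF lin X] insert.IH(1)]
          subspace_tuples[OF sX] sub])
  show "T.dim (tuples (insert i J) X) = card (insert i J) * dim X"
    using T.rank_nullity(2)[OF linear_coordinate fin, of i] insert.hyps insert.IH(2)
    by (simp add: tuples_insert_image[OF sX] tuples_insert_kernel[OF _ sX])
qed

lemma stable_tuples:
  assumes "finite J" "stable X"
  shows "T.stable (tuples J X)"
  using tuples_dim(1)[OF assms(1) stable_fin_dim[OF assms(2)]] stableD[OF assms(2)] ops_zero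
  by (auto simp: T.stable_def tuples_def)

lemma excess_tuples:
  assumes "finite J" "fin_dim_subspace scale E" "stable C"
  shows "T.excess l (tuples J E) (tuples J C) = real (card J) * excess l E C"
proof -
  have "tuples J E \<inter> tuples J C = tuples J (E \<inter> C)" by (auto simp: tuples_def)
  moreover have "fin_dim_subspace scale (E \<inter> C)"
    using assms by (intro fin_dim_subspace_subset[OF assms(2)] subspace_inter)
      (auto simp: stable_subspace fin_dim_subspaceD)
  ultimately show ?thesis
    using tuples_dim(2)[OF assms(1)] stable_fin_dim[OF assms(3)]
    by (simp add: T.excess_def excess_def algebra_simps)
qed

text \<open>Filtering \<open>A\<close> by its coordinates, each graded piece is a stable subspace of the base space,
  so no stable space of tuples beats the tuples over the destabilizing subspace.\<close>

lemma destabilizing_tuples: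
  assumes "finite J" and C: "destabilizing l E C" and E: "fin_dim_subspace scale E"
    and A: "T.stable A" "A \<subseteq> tuples J UNIV"
  shows "T.excess l (tuples J E) A \<le> real (card J) * excess l E C"
    and "T.excess l (tuples J E) A = real (card J) * excess l E C \<Longrightarrow> tuples J C \<subseteq> A \<Longrightarrow>
      A \<subseteq> tuples J C"
proof -
  note sE = fin_dim_subspaceD[OF E]
  have "T.excess l (tuples J E) A \<le> real (card J) * excess l E C \<and>
     (T.excess l (tuples J E) A = real (card J) * excess l E C \<longrightarrow> tuples J C \<subseteq> A \<longrightarrow> A \<subseteq> tuples J C)"
    using assms(1) A
  proof (induction J arbitrary: A)
    case empty
    then have "A = {0}"
      using T.subspace_0[OF T.stable_subspace[OF empty(1)]]
      by (auto simp: tuples_def fun_eq_iff)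
    then show ?case
      using T.subspace_0[OF subspace_tuples[OF stable_subspace[OF destabilizing_stable[OF C]]]]
      by (simp add: T.excess_zero[OF subspace_tuples[OF sE]])
  next
    case (insert i J)
    \<comment> \<open>The pieces of the coordinate filtration: \<open>A1\<close> is the image of
      \<open>A\<close> under the coordinate at \<open>i\<close>, and \<open>A0\<close> is its
      kernel.\<close>
    define A1 where "A1 = (\<lambda>u. u i) ` A"
    define A0 where "A0 = {u \<in> A. u i = 0}"
    note fA = T.stable_fin_dim[OF insert.prems(1)]
    note sA = T.stable_subspace[OF insert.prems(1)]
    have TA: "T \<circ> u \<in> A" if "T \<in> ops" "u \<in> A" for T u
      using T.stableD[OF insert.prems(1)] that by blast
    have "T ` A1 \<subseteq> A1" if "T \<in> ops" for T
      unfolding A1_def using TA[OF that] by (force simp: o_def)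
    with T.rank_nullity(1)[OF linear_coordinate fA, of i]
    have st1: "stable A1" by (simp add: stable_def A1_def)
    have s0: "T.subspace A0"
      unfolding A0_def using sA
      by (auto intro!: T.subspaceI simp: T.subspace_0 T.subspace_add T.subspace_scale fun_scale_apply)
    then have "fin_dim_subspace (fun_scale scale) A0"
      by (rule T.fin_dim_subspace_subset[OF fA]) (simp add: A0_def)
    moreover have "T \<circ> u \<in> A0" if "T \<in> ops" "u \<in> A0" for T u
      using TA[OF that(1)] ops_zero[OF that(1)] that(2) by (simp add: A0_def)
    ultimately have st0: "T.stable A0" unfolding T.stable_def by blast
    have sub0: "A0 \<subseteq> tuples J UNIV"
      using insert.prems(2) by (auto simp: A0_def tuples_def)
    have dimA: "T.dim A = dim A1 + T.dim A0"
      using T.rank_nullity(2)[OF linear_coordinate fA, of i] by (simp add: A1_def A0_def)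
    define P where "P = tuples (insert i J) E \<inter> A"
    have fP: "fin_dim_subspace (fun_scale scale) P"
      unfolding P_def
      by (intro T.fin_dim_subspace_subset[OF fA] T.subspace_inter subspace_tuples sE sA) simp
    have fE1: "fin_dim_subspace scale (E \<inter> A1)"
      by (intro fin_dim_subspace_subset[OF E] subspace_inter sE stable_subspace st1) simp
    \<comment> \<open>On \<open>P\<close> the coordinate has image inside
      \<open>E \<inter> A1\<close> and kernel \<open>tuples J E \<inter> A0\<close>. Hence the
      excess of \<open>A\<close> is at most the sum of the excesses of the two pieces.\<close>
    have "dim ((\<lambda>u. u i) ` P) \<le> dim (E \<inter> A1)"
      by (intro fin_dim_subspace_dim_mono fE1
          fin_dim_subspaceD[OF T.rank_nullity(1)[OF linear_coordinate fP]])
        (auto simp: P_def A1_def tuples_def)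
    moreover have "{u \<in> P. u i = 0} = tuples J E \<inter> A0"
      using insert.hyps(2) subspace_0[OF sE] by (auto simp: P_def A0_def tuples_def)
    ultimately have "T.dim P \<le> dim (E \<inter> A1) + T.dim (tuples J E \<inter> A0)"
      using T.rank_nullity(2)[OF linear_coordinate fP, of i] by simp
    then have ex: "T.excess l (tuples (insert i J) E) A \<le> excess l E A1 + T.excess l (tuples J E) A0"
      by (simp add: T.excess_def excess_def dimA P_def[symmetric] algebra_simps)
    have le1: "excess l E A1 \<le> excess l E C" by (rule destabilizing_max[OF C st1])
    have le0: "T.excess l (tuples J E) A0 \<le> real (card J) * excess l E C"
      using insert.IH[OF st0 sub0] by blast
    have card: "real (card (insert i J)) * excess l E C = excess l E C + real (card J) * excess l E C"
      using insert.hyps by (simp add: algebra_simps)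
    show ?case
    proof (intro conjI impI)
      show "T.excess l (tuples (insert i J) E) A \<le> real (card (insert i J)) * excess l E C"
        using ex le1 le0 card by linarith
      assume eq: "T.excess l (tuples (insert i J) E) A = real (card (insert i J)) * excess l E C"
        and sub: "tuples (insert i J) C \<subseteq> A"
      \<comment> \<open>Both summands of the upper bound must be attained, so \<open>A1\<close> is a
        maximizer and hence contained in \<open>C\<close>.\<close>
      have "excess l E A1 = excess l E C"
        and eq0: "T.excess l (tuples J E) A0 = real (card J) * excess l E C"
        using ex le1 le0 card eq by linarith+
      then have A1: "A1 \<subseteq> C" using C st1 by (auto simp: destabilizing_def)
      note sC = stable_subspace[OF destabilizing_stable[OF C]]
      have "tuples J C \<subseteq> A0"
        using sub insert.hyps(2) subspace_0[OF sC] by (auto simp: A0_def tuples_def)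
      then have A0: "A0 \<subseteq> tuples J C" using insert.IH[OF st0 sub0] eq0 by blast
      show "A \<subseteq> tuples (insert i J) C"
      proof
        fix u assume u: "u \<in> A"
        then have ui: "u i \<in> C" using A1 by (auto simp: A1_def)
        \<comment> \<open>Subtracting \<open>e\<close> moves \<open>u\<close> into the kernel
          \<open>A0\<close>. That \<open>e\<close> lies in \<open>A\<close> comes from the
          assumption that \<open>A\<close> contains all tuples over \<open>C\<close>.\<close>
        define e where "e = (\<lambda>j. if j = i then u i else 0)"
        have "e \<in> tuples (insert i J) C"
          using ui subspace_0[OF sC] by (auto simp: e_def tuples_def)
        then have "u - e \<in> A" using sub u sA by (blast intro: T.subspace_diff)
        then have "u - e \<in> A0" by (simp add: A0_def e_def)
        then have "u - e \<in> tuples J C" using A0 by blast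
        then have "(u - e) j \<in> C" if "j \<in> J" for j
          using that by (simp add: tuples_def)
        then have "u j \<in> C" if "j \<in> J" for j
          using that insert.hyps(2) by (metis diff_zero e_def minus_apply)
        moreover have "u j = 0" if "j \<notin> insert i J" for j
          using insert.prems(2) u that by (auto simp: tuples_def)
        ultimately show "u \<in> tuples (insert i J) C" using ui by (auto simp: tuples_def)
      qed
    qed
  qed
  then show "T.excess l (tuples J E) A \<le> real (card J) * excess l E C"
    and "T.excess l (tuples J E) A = real (card J) * excess l E C \<Longrightarrow> tuples J C \<subseteq> A \<Longrightarrow>
      A \<subseteq> tuples J C" by blast+
qed

text \<open>Let \<open>A\<close> be the image of the tuples over \<open>C\<close>, and
  \<open>B\<close> the tuples over \<open>D\<close>. By \<open>st1\<close>, \<open>A\<close> is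
  stable; by \<open>st2\<close>, so is the preimage \<open>X\<close> of \<open>B\<close>, whose
  excess is therefore at most that of the tuples over \<open>C\<close>. As \<open>g\<close> maps
  tuples over \<open>E\<close> into tuples over \<open>E'\<close>, the excess with respect to
  \<open>E'\<close> does not drop from \<open>A \<inter> B\<close> to \<open>A\<close>.
  Supermodularity makes \<open>A + B\<close> a maximizer, so it lies in \<open>B\<close>.\<close>

lemma destabilizing_transport:
  assumes g: "Vector_Spaces.linear (fun_scale scale) (fun_scale scale) g"
    and g_inj: "\<And>u. u \<in> tuples index UNIV \<Longrightarrow> g u = 0 \<Longrightarrow> u = 0"
    and g_tuples: "g ` tuples index UNIV \<subseteq> tuples index UNIV"
    and E: "fin_dim_subspace scale E" and E': "fin_dim_subspace scale E'"
    and gE: "g ` tuples index E \<subseteq> tuples index E'"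
    and C: "destabilizing l E C" and D: "destabilizing l E' D"
    and st1: "\<And>T u. T \<in> ops \<Longrightarrow> u \<in> tuples index C \<Longrightarrow> T \<circ> g u \<in> g ` tuples index C"
    and st2: "\<And>T u. T \<in> ops \<Longrightarrow> u \<in> tuples index C \<Longrightarrow> g u \<in> tuples index D \<Longrightarrow>
      g (T \<circ> u) \<in> tuples index D"
  shows "g ` tuples index C \<subseteq> tuples index D"
proof -
  interpret g: Vector_Spaces.linear "fun_scale scale" "fun_scale scale" g by (rule g)
  define CI where "CI = tuples index C"
  define B where "B = tuples index D"
  define EI where "EI = tuples index E"
  define EI' where "EI' = tuples index E'"
  define A where "A = g ` CI"
  define X where "X = {u \<in> CI. g u \<in> B}"
  define S where "S = {x + y | x y. x \<in> A \<and> y \<in> B}"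
  note defs = CI_def B_def EI_def EI'_def
  have stCI: "T.stable CI" and stB: "T.stable B"
    unfolding defs by (intro stable_tuples finite_index destabilizing_stable[OF C] destabilizing_stable[OF D])+
  note fCI = T.stable_fin_dim[OF stCI] and fB = T.stable_fin_dim[OF stB]
  note sCI = T.stable_subspace[OF stCI] and sB = T.stable_subspace[OF stB]
  have fEI: "fin_dim_subspace (fun_scale scale) EI" and fEI': "fin_dim_subspace (fun_scale scale) EI'"
    unfolding defs by (intro tuples_dim finite_index E E')+
  note sEI = T.fin_dim_subspaceD[OF fEI] and sEI' = T.fin_dim_subspaceD[OF fEI']
  have inj: "u = 0" if "u \<in> CI" "g u = 0" for u
    using g_inj[OF _ that(2)] that(1) by (auto simp: CI_def tuples_def)
  have inj2: "u = v" if "u \<in> tuples index UNIV" "v \<in> tuples index UNIV" "g u = g v" for u v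
  proof -
    have "u - v \<in> tuples index UNIV"
      using that subspace_tuples[OF subspace_UNIV] by (blast intro: T.subspace_diff)
    then show ?thesis using g_inj[of "u - v"] that(3) by (simp add: g.diff)
  qed
  have stA: "T.stable A"
    using T.rank_nullity(1)[OF g fCI] st1 by (auto simp: T.stable_def A_def CI_def)
  note fA = T.stable_fin_dim[OF stA] and sA = T.stable_subspace[OF stA]
  have sX: "T.subspace X"
    unfolding X_def using sCI sB
    by (auto intro!: T.subspaceI simp: T.subspace_0 T.subspace_add T.subspace_scale g.add g.scale)
  have fX: "fin_dim_subspace (fun_scale scale) X"
    by (rule T.fin_dim_subspace_subset[OF fCI sX]) (simp add: X_def)
  have "T.stable X"
    using fX st2 T.stableD[OF stCI] by (auto simp: T.stable_def X_def CI_def B_def)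
  moreover have "X \<subseteq> tuples index UNIV" by (auto simp: X_def CI_def tuples_def)
  ultimately have "T.excess l EI X \<le> real (card index) * excess l E C"
    unfolding EI_def by (intro destabilizing_tuples(1) finite_index C E)
  also have "\<dots> = T.excess l EI CI"
    unfolding EI_def CI_def by (rule excess_tuples[OF finite_index E destabilizing_stable[OF C], symmetric])
  finally have main: "T.excess l EI X \<le> T.excess l EI CI" .
  have AB: "A \<inter> B = g ` X" by (auto simp: A_def X_def)
  have dimA: "T.dim A = T.dim CI"
    unfolding A_def by (rule T.dim_linear_image_inj_on[OF g fCI inj])
  have dimAB: "T.dim (A \<inter> B) = T.dim X"
    unfolding AB by (rule T.dim_linear_image_inj_on[OF g fX inj]) (auto simp: X_def)
  define GE where "GE = g ` EI"
  have fGE: "fin_dim_subspace (fun_scale scale) GE" unfolding GE_def by (rule T.rank_nullity(1)[OF g fEI])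
  note sGE = T.fin_dim_subspaceD[OF fGE]
  have EU: "EI \<subseteq> tuples index UNIV" "CI \<subseteq> tuples index UNIV" by (auto simp: defs tuples_def)
  have img1: "GE \<inter> A = g ` (EI \<inter> CI)"
    unfolding GE_def A_def using inj2 EU by blast
  have img2: "GE \<inter> (A \<inter> B) = g ` (EI \<inter> X)"
    unfolding GE_def AB using inj2 EU by (auto simp: X_def) blast
  have fin_sub: "fin_dim_subspace (fun_scale scale) (Y \<inter> Z)"
    if "fin_dim_subspace (fun_scale scale) Y" "T.subspace Z" for Y Z
    by (rule T.fin_dim_subspace_subset[OF that(1) T.subspace_inter[OF T.fin_dim_subspaceD[OF that(1)] that(2)]])
      simp
  have dim1: "T.dim (GE \<inter> A) = T.dim (EI \<inter> CI)"
    unfolding img1 by (rule T.dim_linear_image_inj_on[OF g fin_sub[OF fEI sCI] inj]) simp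
  have dim2: "T.dim (GE \<inter> (A \<inter> B)) = T.dim (EI \<inter> X)"
    unfolding img2 by (rule T.dim_linear_image_inj_on[OF g fin_sub[OF fEI sX] inj]) (auto simp: X_def)
  have GE_le: "GE \<subseteq> EI'" using gE by (simp add: GE_def defs)
  have sAB: "T.subspace (A \<inter> B)" using sA sB by (rule T.subspace_inter)
  \<comment> \<open>Both spaces lie in \<open>EI' \<inter> A\<close> and they meet in
    \<open>GE \<inter> (A \<inter> B)\<close>. By the dimension formula, passing from
    \<open>A \<inter> B\<close> to \<open>A\<close> adds at least as many dimensions inside
    \<open>EI'\<close> as inside \<open>GE\<close>.\<close>
  let ?Y = "EI' \<inter> (A \<inter> B)" and ?Z = "GE \<inter> A"
  note sEA = T.subspace_inter[OF sEI' sA]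
  have "{x + y | x y. x \<in> ?Y \<and> y \<in> ?Z} \<subseteq> EI' \<inter> A"
    using GE_le T.subspace_add[OF sEA] by blast
  then have "T.dim {x + y | x y. x \<in> ?Y \<and> y \<in> ?Z} \<le> T.dim (EI' \<inter> A)"
    by (intro T.fin_dim_subspace_dim_mono fin_sub fEI' sA T.subspace_sums T.subspace_inter sEI' sAB sGE)
  moreover have "?Y \<inter> ?Z = GE \<inter> (A \<inter> B)" using GE_le by blast
  ultimately have "T.dim ?Y + T.dim ?Z \<le> T.dim (EI' \<inter> A) + T.dim (GE \<inter> (A \<inter> B))"
    using T.dim_sums_Int_fin_dim[OF fin_sub[OF fEI' sAB] fin_sub[OF fGE sA]] by simp
  then have "T.excess l EI CI - T.excess l EI X \<le> T.excess l EI' A - T.excess l EI' (A \<inter> B)"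
    unfolding T.excess_def dimA dimAB dim1 dim2 by linarith
  with T.excess_supermodular[OF fEI' stA stB, of l] main
  have "T.excess l EI' B \<le> T.excess l EI' S" unfolding S_def by linarith
  moreover have "T.excess l EI' B = real (card index) * excess l E' D"
    unfolding defs by (rule excess_tuples[OF finite_index E' destabilizing_stable[OF D]])
  ultimately have ge: "real (card index) * excess l E' D \<le> T.excess l EI' S" by simp
  have stS: "T.stable S" unfolding S_def by (rule T.stable_sums[OF stA stB])
  have "A \<subseteq> tuples index UNIV" using g_tuples EU(2) unfolding A_def by blast
  moreover have "B \<subseteq> tuples index UNIV" by (auto simp: B_def tuples_def)
  ultimately have SU: "S \<subseteq> tuples index UNIV"
    using T.subspace_add[OF subspace_tuples[OF subspace_UNIV]] unfolding S_def by blast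
  note max = destabilizing_tuples[OF finite_index D E' stS SU, folded B_def EI'_def]
  \<comment> \<open>The equality case of \<open>destabilizing_tuples\<close> applies to spaces that
    contain the tuples over \<open>D\<close>, which is why \<open>S\<close> is used instead of
    \<open>A\<close>.\<close>
  have "B \<subseteq> S" using T.subspace_0[OF sA] unfolding S_def by force
  then have "S \<subseteq> B" using max(2) max(1) ge by (metis order_antisym)
  moreover have "x \<in> S" if "x \<in> A" for x
    unfolding S_def using that T.subspace_0[OF sB] by (intro CollectI exI[of _ x] exI[of _ 0]) simp
  ultimately show ?thesis by (auto simp: A_def B_def CI_def)
qed

end

section \<open>Averaging dimensions of destabilizing subspaces over the slope\<close>

context operator_space
begin

text \<open>The maximal excess is a convex piecewise linear function of \<open>l\<close> whose slope is minus the
  dimension of the destabilizing subspace, so dimensions of the subspaces themselves are recovered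
  by integrating over \<open>l\<close>; the integral is replaced by Riemann sums.\<close>

lemma destabilizing_average:
  assumes E: "fin_dim_subspace scale E" and E': "fin_dim_subspace scale E'"
    and W: "stable W" "E \<subseteq> W" and c: "0 \<le> c"
    and ex: "\<And>l. 0 < l \<Longrightarrow> l \<le> 1 \<Longrightarrow>
      \<exists>C D. destabilizing l E C \<and> destabilizing l E' D \<and> c * real (dim C) \<le> real (dim D)"
  shows "c * real (dim E) \<le> real (dim E')"
proof -
  note sE = fin_dim_subspaceD[OF E] and sE' = fin_dim_subspaceD[OF E']
  obtain C D where CD: "\<And>l. 0 < l \<Longrightarrow> l \<le> 1 \<Longrightarrow>
      destabilizing l E (C l) \<and> destabilizing l E' (D l) \<and> c * real (dim (C l)) \<le> real (dim (D l))"
    using ex by metis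
  define v where "v l = excess l E (C l)" for l
  define v' where "v' l = excess l E' (D l)" for l
  have shift: "excess l F X = excess l' F X + (l' - l) * real (dim X)" for l l' F X
    by (simp add: excess_def algebra_simps)
  \<comment> \<open>The subspace optimal at \<open>l\<close> competes at \<open>l'\<close>, so
    \<open>v\<close> lies above the line through \<open>(l, v l)\<close> with slope
    \<open>- dim (C l)\<close>.\<close>
  have v_step: "v l - v l' \<le> (l' - l) * real (dim (C l))" if "0 < l" "l \<le> l'" "l' \<le> 1" for l l'
  proof -
    have "excess l' E (C l) \<le> v l'"
      unfolding v_def using CD[of l] CD[of l'] that
      by (intro destabilizing_max destabilizing_stable[of l E]) auto
    with shift[of l E "C l" l'] show ?thesis unfolding v_def by linarith
  qed
  \<comment> \<open>Here the subspace optimal at \<open>l'\<close> competes at \<open>l\<close>,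
    which bounds the decrease from below by the dimension at the right endpoint.\<close>
  have v'_step: "(l' - l) * real (dim (D l')) \<le> v' l - v' l'" if "0 < l" "l \<le> l'" "l' \<le> 1" for l l'
  proof -
    have "excess l E' (D l') \<le> v' l"
      unfolding v'_def using CD[of l] CD[of l'] that
      by (intro destabilizing_max destabilizing_stable[of l' E']) auto
    with shift[of l E' "D l'" l'] show ?thesis unfolding v'_def by linarith
  qed
  \<comment> \<open>At \<open>l = 1\<close> no subspace has positive excess.\<close>
  have v1: "v 1 \<le> 0"
  proof -
    have "dim (E \<inter> C 1) \<le> dim (C 1)"
      using CD[of 1] sE by (intro fin_dim_subspace_dim_mono subspace_inter)
        (auto intro: stable_fin_dim stable_subspace destabilizing_stable)
    then show ?thesis by (simp add: v_def excess_def)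
  qed
  have v'_ge: "0 \<le> v' l" if "0 < l" "l \<le> 1" for l
    using destabilizing_max[OF _ stable_zero, of l E' "D l"] CD[OF that] excess_zero[OF sE', of l]
    by (simp add: v'_def)
  have v'_le: "v' l \<le> real (dim E')" if "0 < l" "l \<le> 1" for l
  proof -
    have "dim (E' \<inter> D l) \<le> dim E'"
      using CD[OF that] sE' by (intro fin_dim_subspace_dim_mono[OF E'] subspace_inter)
        (auto intro: stable_subspace destabilizing_stable)
    moreover have "0 \<le> l * real (dim (D l))" using that by simp
    ultimately show ?thesis by (simp add: v'_def excess_def)
  qed
  \<comment> \<open>For \<open>l\<close> near 0 the competitor \<open>W\<close>, which contains all
    of \<open>E\<close>, keeps \<open>v\<close> from falling far below \<open>dim E\<close>.\<close>
  have v_ge: "real (dim E) - l * real (dim W) \<le> v l" if "0 < l" "l \<le> 1" for l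
    using destabilizing_max[OF _ W(1), of l E "C l"] CD[OF that] W(2)
    by (simp add: v_def excess_def Int_absorb2)
  have main: "c * (real (dim E) - 2 / real N * real (dim W)) \<le> real (dim E')" if "N \<ge> 2" for N :: nat
  proof -
    define p where "p j = real j / real N" for j
    have p: "0 < p j" "p j \<le> 1" "p (j + 1) - p j = 1 / real N" "p j \<le> p (j + 1)"
      if "0 < j" "j \<le> N" for j
      using that \<open>N \<ge> 2\<close> by (simp_all add: p_def field_simps)
    \<comment> \<open>The decrease of \<open>v\<close> is bounded through the left endpoint of an
      interval, that of \<open>v'\<close> through the right one. Shifting \<open>v\<close> by one
      grid point makes both bounds refer to \<open>p (j + 1)\<close>. The induction descends from
      \<open>N - 1\<close>.\<close>
    have claim: "c * v (p (j + 1)) \<le> v' (p j)" if "1 \<le> j" "j \<le> N - 1" for j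
      using that(2,1)
    proof (induction rule: inc_induct)
      case base
      have "p (N - 1 + 1) = 1" using \<open>N \<ge> 2\<close> by (simp add: p_def)
      then have "c * v (p (N - 1 + 1)) \<le> 0" using v1 c by (simp add: mult_nonneg_nonpos)
      also have "0 \<le> v' (p (N - 1))" using \<open>N \<ge> 2\<close> by (intro v'_ge p) auto
      finally show ?case .
    next
      case (step j)
      let ?d = "1 / real N"
      have j: "0 < j" "j + 1 < N" using step by auto
      note pj = p[of j] p[of "j + 1"] p[of "j + 2"]
      have "c * (v (p (j + 1)) - v (p (j + 2))) \<le> c * (?d * real (dim (C (p (j + 1)))))"
        using v_step[of "p (j + 1)" "p (j + 2)"] pj j c by (intro mult_left_mono) auto
      also have "\<dots> \<le> ?d * real (dim (D (p (j + 1))))"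
        using CD[of "p (j + 1)"] pj j mult_left_mono[of "c * real (dim (C (p (j + 1))))" _ ?d]
        by (simp add: algebra_simps)
      also have "\<dots> \<le> v' (p j) - v' (p (j + 1))"
        using v'_step[of "p j" "p (j + 1)"] pj j by auto
      finally have "c * v (p (j + 1)) - c * v (p (j + 2)) \<le> v' (p j) - v' (p (j + 1))"
        by (simp add: algebra_simps)
      moreover have "c * v (p (j + 2)) \<le> v' (p (j + 1))"
        using step.IH by simp
      ultimately show ?case by linarith
    qed
    \<comment> \<open>The \<open>2\<close> stems from the shift: the claim for \<open>j = 1\<close>
      compares \<open>v\<close> at \<open>p 2 = 2 / N\<close> with \<open>v'\<close> at
      \<open>p 1\<close>. The error vanishes as \<open>N\<close> grows.\<close>
    have "c * (real (dim E) - 2 / real N * real (dim W)) \<le> c * v (p 2)"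
      using v_ge[of "p 2"] \<open>N \<ge> 2\<close> c by (intro mult_left_mono) (auto simp: p_def)
    also have "\<dots> \<le> v' (p 1)" using claim[of 1] \<open>N \<ge> 2\<close> by (simp add: numeral_2_eq_2)
    also have "\<dots> \<le> real (dim E')" using \<open>N \<ge> 2\<close> by (intro v'_le p) auto
    finally show ?thesis .
  qed
  have "(\<lambda>N. c * (real (dim E) - 2 / real N * real (dim W))) \<longlonglongrightarrow> c * (real (dim E) - 0 * real (dim W))"
    by (intro tendsto_intros lim_const_over_n)
  then show ?thesis
    using main by (intro LIMSEQ_le_const2[of _ "c * real (dim E)"]) auto
qed

end

section \<open>Coalgebras and slices\<close>

text \<open>A new term \<open>P a b\<close> is distributed over \<open>S\<close> if \<open>a\<close>
  lies in the span of \<open>S\<close>, and otherwise \<open>a\<close> joins \<open>S\<close>. With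
  independent \<open>S\<close>, dual functionals later isolate the factors \<open>y s\<close>. The
  map \<open>P\<close> is general so that the two tensor factors may be exchanged.\<close>

lemma bilinear_span_expansion:
  assumes P: "bilinear_map s1 s2 s3 P" and A: "module.subspace s1 A"
    and d: "d \<in> module.span s3 {P a b | a b. a \<in> A}"
  obtains S y where "finite S" "S \<subseteq> A" "\<not> module.dependent s1 S" "d = (\<Sum>s\<in>S. P s (y s))"
proof -
  interpret v1: vector_space s1 by (rule bilinear_mapD[OF P])
  interpret v2: vector_space s2 by (rule bilinear_mapD[OF P])
  interpret v3: vector_space s3 by (rule bilinear_mapD[OF P])
  note bP = bilinear_mapD(4-7)[OF P]
  have P_zero: "P 0 b = 0" for b using bP(1)[of 0 0 b] by simp
  have P_sum: "P (sum f T) b = (\<Sum>i\<in>T. P (f i) b)" for f T b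
    by (induction T rule: infinite_finite_induct) (simp_all add: P_zero bP(1))
  have "\<exists>S y. finite S \<and> S \<subseteq> A \<and> \<not> v1.dependent S \<and> d = (\<Sum>s\<in>S. P s (y s))"
    using d
  proof (induction rule: v3.span_induct_alt)
    case base
    show ?case by (intro exI[of _ "{}"]) (simp add: v1.independent_empty)
  next
    case (step c x d)
    then obtain a b where ab: "a \<in> A" "x = P a b" by blast
    from step obtain S y where S: "finite S" "S \<subseteq> A" "\<not> v1.dependent S" "d = (\<Sum>s\<in>S. P s (y s))"
      by blast
    show ?case
    proof (cases "a \<in> v1.span S")
      case True
      then obtain u where u: "a = (\<Sum>s\<in>S. s1 (u s) s)"
        using v1.span_finite[OF S(1)] by auto
      have "s3 c x + d = (\<Sum>s\<in>S. P s (s2 (c * u s) b + y s))"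
        unfolding S(4) ab(2) u P_sum
        by (simp add: bP v3.scale_sum_right sum.distrib)
      with S show ?thesis by (intro exI[of _ S] exI[of _ "\<lambda>s. s2 (c * u s) b + y s"]) auto
    next
      case False
      then have "a \<notin> S" using v1.span_base by blast
      then have "s3 c x + d = (\<Sum>s\<in>insert a S. P s ((y(a := s2 c b)) s))"
        using S(1,4) by (auto simp: ab(2) bP intro!: sum.cong)
      moreover have "\<not> v1.dependent (insert a S)"
        using False S(3) by (rule v1.independent_insertI)
      ultimately show ?thesis using S ab
        by (intro exI[of _ "insert a S"] exI[of _ "y(a := s2 c b)"]) auto
    qed
  qed
  with that show ?thesis by blast
qed

lemma (in vector_space) dual_basis_exists:
  assumes "independent S"
  obtains \<delta> where "\<And>s. s \<in> S \<Longrightarrow> Vector_Spaces.linear scale (*) (\<delta> s)"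
    "\<And>s t. s \<in> S \<Longrightarrow> t \<in> S \<Longrightarrow> \<delta> s t = (if s = t then 1 else 0)"
proof -
  interpret P: vector_space_pair scale "(*) :: 'a \<Rightarrow> 'a \<Rightarrow> 'a"
    by (intro vector_space_pair.intro vector_space_axioms vector_space_field)
  have "\<exists>\<phi>. Vector_Spaces.linear scale (*) \<phi> \<and> (\<forall>t\<in>S. \<phi> t = (if s = t then 1 else 0))" for s
    using P.linear_independent_extend[OF assms, of "\<lambda>t. if s = t then 1 else 0"] by blast
  then show ?thesis using that by metis
qed

section \<open>Sweedler sums of bilinear and trilinear maps\<close>

context coalgebra
begin

text \<open>For bilinear \<open>B\<close> this is B(x_(1), x_(2)) in Sweedler's notation.\<close>

definition sweedler :: "('k \<Rightarrow> 'd::ab_group_add \<Rightarrow> 'd) \<Rightarrow> ('c \<Rightarrow> 'c \<Rightarrow> 'd) \<Rightarrow> 'c \<Rightarrow> 'd" where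
  "sweedler s B x = tensor_lift scale scale s B (comult x)"

lemma sweedler_linear:
  assumes "bilinear_map scale scale s B"
  shows "Vector_Spaces.linear scale s (sweedler s B)"
  using bilinear_mapD(1-3)[OF assms]
  by (intro linearI') (simp_all add: sweedler_def linearD'(3,4)[OF linear_tensor_lift[OF assms]]
      linearD'(3,4)[OF comult_linear])

lemma linear_sweedler:
  assumes "Vector_Spaces.linear s s' f" "bilinear_map scale scale s B"
  shows "f (sweedler s B x) = sweedler s' (\<lambda>a b. f (B a b)) x"
  unfolding sweedler_def
proof (rule tensor_lift_unique[symmetric])
  note f = linearD'[OF assms(1)] and B = bilinear_mapD[OF assms(2)]
  show "bilinear_map scale scale s' (\<lambda>a b. f (B a b))"
    using f(1,2) B(1-3) by (intro bilinear_mapI) (simp_all add: f B)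
  show "Vector_Spaces.linear tensor_scale s' (\<lambda>t. f (tensor_lift scale scale s B t))"
    by (intro linearI' f vector_space_tensor_scale)
      (simp_all add: f linearD'(3,4)[OF linear_tensor_lift[OF assms(2)]])
qed (simp_all add: tensor_lift_simple[OF assms(2)] comult_in)

lemma sweedler_add_scale:
  assumes "bilinear_map scale scale s B" "bilinear_map scale scale s B'"
  shows "sweedler s (\<lambda>a b. B a b + B' a b) x = sweedler s B x + sweedler s B' x"
    and "sweedler s (\<lambda>a b. s c (B a b)) x = s c (sweedler s B x)"
  unfolding sweedler_def by (rule tensor_lift_add_scale[OF assms comult_in])+

text \<open>The trilinear map \<open>T\<close> induces a linear map \<open>L\<close> on the
  threefold tensor product, and the two sides are \<open>L\<close> applied to the two sides of
  \<open>coassoc\<close>.\<close>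

lemma sweedler_coassoc:
  fixes T :: "'c \<Rightarrow> 'c \<Rightarrow> 'c \<Rightarrow> 'd::ab_group_add"
  assumes T12: "\<And>y. bilinear_map scale scale s (\<lambda>a b. T a b y)"
    and T23: "\<And>x. bilinear_map scale scale s (\<lambda>a b. T x a b)"
  shows "sweedler s (\<lambda>x y. sweedler s (\<lambda>a b. T a b y) x) m =
         sweedler s (\<lambda>x y. sweedler s (\<lambda>a b. T x a b) y) m"
proof -
  have vs: "vector_space s" by (rule bilinear_mapD[OF T12])
  have T_add: "T a b (y + y') = T a b y + T a b y'" "T (x + x') a b = T x a b + T x' a b"
    and T_scale: "T a b (scale c y) = s c (T a b y)" "T (scale c x) a b = s c (T x a b)"
    for a b c x x' y y'
    using bilinear_mapD(5,7)[OF T23] bilinear_mapD(4,6)[OF T12] by auto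
  have B1: "bilinear_map scale scale s (\<lambda>x y. sweedler s (\<lambda>a b. T a b y) x)"
    by (intro bilinear_mapI vs vector_space_axioms)
      (simp_all add: linearD'(3,4)[OF sweedler_linear[OF T12]] T_add T_scale
        sweedler_add_scale[OF T12 T12])
  have B2: "bilinear_map scale scale s (\<lambda>x y. sweedler s (\<lambda>a b. T x a b) y)"
    by (intro bilinear_mapI vs vector_space_axioms)
      (simp_all add: linearD'(3,4)[OF sweedler_linear[OF T23]] T_add T_scale
        sweedler_add_scale[OF T23 T23])
  \<comment> \<open>\<open>tensor_lift\<close> is linear in its bilinear argument only on the tensor
    space, a subspace of the tensor type; projecting onto it first makes \<open>G\<close> bilinear
    on the whole type.\<close>
  obtain \<pi> :: "('c, 'c, 'k) tensor \<Rightarrow> ('c, 'c, 'k) tensor"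
    where \<pi>: "Vector_Spaces.linear tensor_scale tensor_scale \<pi>"
    "\<And>t. \<pi> t \<in> tensor_space scale scale" "\<And>t. t \<in> tensor_space scale scale \<Longrightarrow> \<pi> t = t"
    by (rule tensor_projection[of scale scale]) blast
  define G where "G x t = tensor_lift scale scale s (T x) (\<pi> t)" for x t
  have T_fun: "T (x + x') = (\<lambda>a b. T x a b + T x' a b)" "T (scale c x) = (\<lambda>a b. s c (T x a b))"
    for x x' c by (simp_all add: fun_eq_iff T_add T_scale)
  have G: "bilinear_map scale tensor_scale s G"
    by (intro bilinear_mapI vs vector_space_axioms vector_space_tensor_scale)
      (simp_all add: G_def T_fun linearD'(3,4)[OF \<pi>(1)] linearD'(3,4)[OF linear_tensor_lift[OF T23]]
        tensor_lift_add_scale[OF T23 T23 \<pi>(2)])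
  define L where "L = tensor_lift scale tensor_scale s G"
  note linL = linear_tensor_lift[OF G, folded L_def]
  have L_simple: "L (simple_tensor scale tensor_scale a t) = G a t" for a t
    unfolding L_def by (rule tensor_lift_simple[OF G])
  define i where "i = (id :: 'c \<Rightarrow> 'c)"
  have i: "i x = x" for x by (simp add: i_def)
  have id: "Vector_Spaces.linear scale scale i"
    by (intro linearI' vector_space_axioms) (simp_all add: i)
  note assoc = linear_tensor_assoc[OF vector_space_axioms vector_space_axioms vector_space_axioms]
  note map1 = linear_tensor_map[OF comult_linear id] and map2 = linear_tensor_map[OF id comult_linear]
  have tm: "tensor_map scale scale tensor_scale scale comult i (simple_tensor scale scale a b) =
      simple_tensor tensor_scale scale (comult a) b"
    "tensor_map scale scale scale tensor_scale i comult (simple_tensor scale scale a b) =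
      simple_tensor scale tensor_scale a (comult b)" for a b
    unfolding tensor_map_simple[OF comult_linear id] tensor_map_simple[OF id comult_linear] i
    by (rule refl)+
  let ?as = "tensor_assoc scale scale scale"
  have inner: "L (?as (simple_tensor tensor_scale scale t y)) = tensor_lift scale scale s (\<lambda>a b. T a b y) t"
    if "t \<in> tensor_space scale scale" for t y
  proof (rule tensor_lift_unique[symmetric, OF T12 _ _ that])
    note st = bilinear_mapD(4,6)[OF bilinear_simple_tensor[OF vector_space_tensor_scale vector_space_axioms]]
    show "Vector_Spaces.linear tensor_scale s (\<lambda>t. L (?as (simple_tensor tensor_scale scale t y)))"
      by (intro linearI' vs vector_space_tensor_scale)
        (simp_all add: st linearD'(3,4)[OF assoc] linearD'(3,4)[OF linL])
    show "L (?as (simple_tensor tensor_scale scale (simple_tensor scale scale a b) y)) = T a b y" for a b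
      by (simp add: tensor_assoc_simple[OF vector_space_axioms vector_space_axioms vector_space_axioms]
          L_simple G_def \<pi>(3) simple_tensor_in_tensor_space tensor_lift_simple[OF T23])
  qed
  have "sweedler s (\<lambda>x y. sweedler s (\<lambda>a b. T a b y) x) m =
      L (?as (tensor_map scale scale tensor_scale scale comult i (comult m)))"
    unfolding sweedler_def[of s "\<lambda>x y. sweedler s (\<lambda>a b. T a b y) x"]
  proof (rule tensor_lift_unique[OF B1 _ _ comult_in])
    show "Vector_Spaces.linear tensor_scale s
        (\<lambda>t. L (?as (tensor_map scale scale tensor_scale scale comult i t)))"
      by (intro linearI' vs vector_space_tensor_scale)
        (simp_all add: linearD'(3,4)[OF map1] linearD'(3,4)[OF assoc] linearD'(3,4)[OF linL])
  qed (simp add: tm inner comult_in sweedler_def)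
  also have "\<dots> = L (tensor_map scale scale scale tensor_scale i comult (comult m))"
    by (simp add: coassoc[folded i_def])
  also have "\<dots> = sweedler s (\<lambda>x y. sweedler s (\<lambda>a b. T x a b) y) m"
    unfolding sweedler_def[of s "\<lambda>x y. sweedler s (\<lambda>a b. T x a b) y"]
  proof (rule tensor_lift_unique[OF B2 _ _ comult_in, symmetric])
    show "Vector_Spaces.linear tensor_scale s
        (\<lambda>t. L (tensor_map scale scale scale tensor_scale i comult t))"
      by (intro linearI' vs vector_space_tensor_scale)
        (simp_all add: linearD'(3,4)[OF map2] linearD'(3,4)[OF linL])
  qed (simp add: tm L_simple G_def \<pi>(3) comult_in sweedler_def)
  finally show ?thesis .
qed

section \<open>Slices along functionals\<close>

lemma bilinear_slice:
  assumes "Vector_Spaces.linear scale (*) \<phi>"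
  shows "bilinear_map scale scale scale (\<lambda>a b. scale (\<phi> b) a)"
    and "bilinear_map scale scale scale (\<lambda>a b. scale (\<phi> a) b)"
  by (intro bilinear_mapI vector_space_axioms;
      simp add: linearD'(3,4)[OF assms] scale_left_distrib scale_right_distrib mult.commute)+

lemma bilinear_functionals:
  assumes "Vector_Spaces.linear scale (*) \<phi>" "Vector_Spaces.linear scale (*) \<psi>"
  shows "bilinear_map scale scale (*) (\<lambda>a b. \<phi> a * \<psi> b)"
  by (intro bilinear_mapI vector_space_axioms vector_space_field)
    (simp_all add: linearD'(3,4)[OF assms(1)] linearD'(3,4)[OF assms(2)] algebra_simps)

definition right_slice :: "('c \<Rightarrow> 'k) \<Rightarrow> 'c \<Rightarrow> 'c" where
  "right_slice \<phi> = sweedler scale (\<lambda>a b. scale (\<phi> b) a)"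

definition left_slice :: "('c \<Rightarrow> 'k) \<Rightarrow> 'c \<Rightarrow> 'c" where
  "left_slice \<phi> = sweedler scale (\<lambda>a b. scale (\<phi> a) b)"

definition slices :: "('c \<Rightarrow> 'c) set" where
  "slices = {right_slice \<phi> | \<phi>. Vector_Spaces.linear scale (*) \<phi>} \<union>
            {left_slice \<phi> | \<phi>. Vector_Spaces.linear scale (*) \<phi>}"

lemma slice_linear:
  assumes "Vector_Spaces.linear scale (*) \<phi>"
  shows "Vector_Spaces.linear scale scale (right_slice \<phi>)"
    and "Vector_Spaces.linear scale scale (left_slice \<phi>)"
  unfolding right_slice_def left_slice_def by (intro sweedler_linear bilinear_slice assms)+

sublocale slices: operator_space scale slices
  by (intro operator_space.intro operator_space_axioms.intro vector_space_axioms)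
    (auto simp: slices_def slice_linear)

text \<open>The counit axioms live in tensor products with the ground field; the map induced by
  scalar multiplication carries them to the coalgebra.\<close>

lemma slice_counit: "right_slice counit x = x" "left_slice counit x = x"
proof -
  define i where "i = (id :: 'c \<Rightarrow> 'c)"
  have i: "i x = x" for x by (simp add: i_def)
  have id: "Vector_Spaces.linear scale scale i"
    by (intro linearI' vector_space_axioms) (simp_all add: i)
  have tm: "tensor_map scale scale (*) scale counit i (simple_tensor scale scale a b) =
      simple_tensor (*) scale (counit a) b"
    "tensor_map scale scale scale (*) i counit (simple_tensor scale scale a b) =
      simple_tensor scale (*) a (counit b)" for a b
    unfolding tensor_map_simple[OF counit_linear id] tensor_map_simple[OF id counit_linear] i
    by (rule refl)+
  note b = bilinear_slice[OF counit_linear]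
  have m: "bilinear_map (*) scale scale (\<lambda>r a. scale r a)" "bilinear_map scale (*) scale (\<lambda>a r. scale r a)"
    by (intro bilinear_mapI vector_space_axioms vector_space_field;
        simp add: scale_left_distrib scale_right_distrib mult.commute)+
  have "left_slice counit x = tensor_lift (*) scale scale (\<lambda>r a. scale r a)
      (tensor_map scale scale (*) scale counit i (comult x))"
    unfolding left_slice_def sweedler_def
    by (rule tensor_lift_unique[OF b(2) _ _ comult_in])
      (simp_all add: tm tensor_lift_simple[OF m(1)]
        Vector_Spaces.linear_compose[OF linear_tensor_map[OF counit_linear id] linear_tensor_lift[OF m(1)], unfolded o_def])
  also have "\<dots> = x" by (simp add: counit_left[folded i_def] tensor_lift_simple[OF m(1)])
  finally show "left_slice counit x = x" .
  have "right_slice counit x = tensor_lift scale (*) scale (\<lambda>a r. scale r a)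
      (tensor_map scale scale scale (*) i counit (comult x))"
    unfolding right_slice_def sweedler_def
    by (rule tensor_lift_unique[OF b(1) _ _ comult_in])
      (simp_all add: tm tensor_lift_simple[OF m(2)]
        Vector_Spaces.linear_compose[OF linear_tensor_map[OF id counit_linear] linear_tensor_lift[OF m(2)], unfolded o_def])
  also have "\<dots> = x" by (simp add: counit_right[folded i_def] tensor_lift_simple[OF m(2)])
  finally show "right_slice counit x = x" .
qed

text \<open>The coalgebra is a bimodule over its dual algebra with the convolution product: right
  slices are the left action and left slices the right action. All three laws are instances of
  coassociativity.\<close>

lemma slice_slice:
  assumes \<phi>: "Vector_Spaces.linear scale (*) \<phi>" and \<psi>: "Vector_Spaces.linear scale (*) \<psi>"
  shows "right_slice \<phi> (right_slice \<psi> x) = right_slice (sweedler (*) (\<lambda>a b. \<phi> a * \<psi> b)) x"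
    and "left_slice \<phi> (left_slice \<psi> x) = left_slice (sweedler (*) (\<lambda>a b. \<psi> a * \<phi> b)) x"
    and "right_slice \<phi> (left_slice \<psi> x) = left_slice \<psi> (right_slice \<phi> x)"
proof -
  note lin = linearD'(3,4)[OF \<phi>] linearD'(3,4)[OF \<psi>]
  have scale_r: "Vector_Spaces.linear scale scale (scale r)" for r
    by (intro linearI' vector_space_axioms) (simp_all add: scale_right_distrib mult.commute)
  have scale_l: "Vector_Spaces.linear (*) scale (\<lambda>r. scale r c)" for c
    by (intro linearI' vector_space_axioms vector_space_field) (simp_all add: scale_left_distrib)
  note bil = bilinear_mapI[OF vector_space_axioms vector_space_axioms vector_space_axioms]
  note sl = bilinear_slice[OF \<phi>] bilinear_slice[OF \<psi>]
  note fs = bilinear_functionals[OF \<phi> \<psi>] bilinear_functionals[OF \<psi> \<phi>]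
  show "right_slice \<phi> (right_slice \<psi> x) = right_slice (sweedler (*) (\<lambda>a b. \<phi> a * \<psi> b)) x"
  proof -
    have "right_slice \<phi> (right_slice \<psi> x) = sweedler scale (\<lambda>a b. scale (\<psi> b) (right_slice \<phi> a)) x"
      unfolding right_slice_def[of \<psi>]
      by (simp add: linear_sweedler[OF slice_linear(1)[OF \<phi>] sl(3)]
          linearD'(4)[OF slice_linear(1)[OF \<phi>]])
    also have "\<dots> = sweedler scale (\<lambda>x y. sweedler scale (\<lambda>a b. scale (\<psi> y) (scale (\<phi> b) a)) x) x"
      unfolding right_slice_def by (simp only: linear_sweedler[OF scale_r sl(1)])
    also have "\<dots> = sweedler scale (\<lambda>x y. sweedler scale (\<lambda>a b. scale (\<psi> b) (scale (\<phi> a) x)) y) x"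
      by (rule sweedler_coassoc; rule bil; simp add: lin scale_left_distrib scale_right_distrib algebra_simps)
    also have "\<dots> = right_slice (sweedler (*) (\<lambda>a b. \<phi> a * \<psi> b)) x"
      unfolding right_slice_def
      by (simp add: linear_sweedler[OF scale_l fs(1)] mult.commute)
    finally show ?thesis .
  qed
  show "left_slice \<phi> (left_slice \<psi> x) = left_slice (sweedler (*) (\<lambda>a b. \<psi> a * \<phi> b)) x"
  proof -
    have "left_slice \<phi> (left_slice \<psi> x) = sweedler scale (\<lambda>a b. scale (\<psi> a) (left_slice \<phi> b)) x"
      unfolding left_slice_def[of \<psi>]
      by (simp add: linear_sweedler[OF slice_linear(2)[OF \<phi>] sl(4)]
          linearD'(4)[OF slice_linear(2)[OF \<phi>]])
    also have "\<dots> = sweedler scale (\<lambda>x y. sweedler scale (\<lambda>a b. scale (\<psi> x) (scale (\<phi> a) b)) y) x"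
      unfolding left_slice_def by (simp only: linear_sweedler[OF scale_r sl(2)])
    also have "\<dots> = sweedler scale (\<lambda>x y. sweedler scale (\<lambda>a b. scale (\<psi> a) (scale (\<phi> b) y)) x) x"
      by (rule sweedler_coassoc[symmetric]; rule bil;
          simp add: lin scale_left_distrib scale_right_distrib algebra_simps)
    also have "\<dots> = left_slice (sweedler (*) (\<lambda>a b. \<psi> a * \<phi> b)) x"
      unfolding left_slice_def
      by (intro arg_cong[where f = "\<lambda>B. sweedler scale B x"] ext)
        (simp add: linear_sweedler[OF scale_l fs(2)])
    finally show ?thesis .
  qed
  show "right_slice \<phi> (left_slice \<psi> x) = left_slice \<psi> (right_slice \<phi> x)"
  proof -
    have "right_slice \<phi> (left_slice \<psi> x) = sweedler scale (\<lambda>a b. scale (\<psi> a) (right_slice \<phi> b)) x"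
      unfolding left_slice_def[of \<psi>]
      by (simp add: linear_sweedler[OF slice_linear(1)[OF \<phi>] sl(4)]
          linearD'(4)[OF slice_linear(1)[OF \<phi>]])
    also have "\<dots> = sweedler scale (\<lambda>x y. sweedler scale (\<lambda>a b. scale (\<psi> x) (scale (\<phi> b) a)) y) x"
      unfolding right_slice_def by (simp only: linear_sweedler[OF scale_r sl(1)])
    also have "\<dots> = sweedler scale (\<lambda>x y. sweedler scale (\<lambda>a b. scale (\<psi> a) (scale (\<phi> y) b)) x) x"
      by (rule sweedler_coassoc[symmetric]; rule bil;
          simp add: lin scale_left_distrib scale_right_distrib algebra_simps)
    also have "\<dots> = sweedler scale (\<lambda>x y. sweedler scale (\<lambda>a b. scale (\<phi> y) (scale (\<psi> a) b)) x) x"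
      by (simp add: mult.commute)
    also have "\<dots> = sweedler scale (\<lambda>a b. scale (\<phi> b) (left_slice \<psi> a)) x"
      unfolding left_slice_def by (simp only: linear_sweedler[OF scale_r sl(4)])
    also have "\<dots> = left_slice \<psi> (right_slice \<phi> x)"
      unfolding right_slice_def[of \<phi>]
      by (simp add: linear_sweedler[OF slice_linear(2)[OF \<psi>] sl(1)]
          linearD'(4)[OF slice_linear(2)[OF \<psi>]])
    finally show ?thesis .
  qed
qed

text \<open>If the comultiplication of \<open>e\<close> is written with independent factors on one
  side, slicing along dual functionals returns the factors on the other side, which thus lie in
  \<open>E\<close>. This is done for the left factors and then for the right ones.\<close>

lemma stable_imp_subcoalgebra:
  assumes E: "slices.stable E"
  shows "subcoalgebra E"
  unfolding subcoalgebra_def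
proof (intro conjI subsetI)
  show sE: "subspace E" by (rule slices.stable_subspace[OF E])
  fix t assume "t \<in> comult ` E"
  then obtain e where e: "e \<in> E" "t = comult e" by blast
  interpret V: vector_space "tensor_scale :: 'k \<Rightarrow> ('c, 'c, 'k) tensor \<Rightarrow> _"
    by (rule vector_space_tensor_scale)
  note bil = bilinear_simple_tensor[OF vector_space_axioms vector_space_axioms]
  have bil': "bilinear_map scale scale tensor_scale (\<lambda>b a. simple_tensor scale scale a b)"
    using bilinear_mapD[OF bil] by (intro bilinear_mapI) simp_all
  have expand: "sweedler s B e = (\<Sum>x\<in>S. B (f x) (g x))"
    if B: "bilinear_map scale scale s B" and t: "t = (\<Sum>x\<in>S. simple_tensor scale scale (f x) (g x))"
    for s :: "'k \<Rightarrow> 'c \<Rightarrow> 'c" and B S and f g :: "'c \<Rightarrow> 'c"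
  proof -
    interpret L: Vector_Spaces.linear tensor_scale s "tensor_lift scale scale s B"
      by (rule linear_tensor_lift[OF B])
    show ?thesis
      using t e(2) by (simp add: sweedler_def L.sum tensor_lift_simple[OF B])
  qed
  have "t \<in> V.span {simple_tensor scale scale a b | b a. b \<in> UNIV}"
  proof -
    have "{simple_tensor scale scale a b | a b. a \<in> UNIV \<and> b \<in> UNIV} =
        {simple_tensor scale scale a b | b a. b \<in> UNIV}" by blast
    then show ?thesis using comult_in[of e] e(2) unfolding tensor_span_def by simp
  qed
  then obtain S x where S: "finite S" "independent S" "t = (\<Sum>s\<in>S. simple_tensor scale scale (x s) s)"
    by (rule bilinear_span_expansion[OF bil' subspace_UNIV])
  obtain \<delta> where \<delta>: "\<And>s. s \<in> S \<Longrightarrow> Vector_Spaces.linear scale (*) (\<delta> s)"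
    "\<And>s t. s \<in> S \<Longrightarrow> t \<in> S \<Longrightarrow> \<delta> s t = (if s = t then 1 else 0)"
    using dual_basis_exists[OF S(2)] by blast
  have x: "x s \<in> E" if s: "s \<in> S" for s
  proof -
    have "right_slice (\<delta> s) e = (\<Sum>s'\<in>S. scale (\<delta> s s') (x s'))"
      unfolding right_slice_def by (rule expand[OF bilinear_slice(1)[OF \<delta>(1)[OF s]] S(3)])
    also have "\<dots> = (\<Sum>s'\<in>S. if s = s' then x s' else 0)"
      by (rule sum.cong) (simp_all add: \<delta>(2)[OF s])
    also have "\<dots> = x s" using S(1) s by simp
    finally show ?thesis
      using slices.stableD[OF E _ e(1), of "right_slice (\<delta> s)"] \<delta>(1)[OF s]
      by (auto simp: slices_def)
  qed
  \<comment> \<open>Knowing that the left factors can be taken in \<open>E\<close>, the tensor is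
    expanded again, now with independent left factors inside \<open>E\<close>.\<close>
  have "t \<in> V.span {simple_tensor scale scale a b | a b. a \<in> E}"
    unfolding S(3) using x by (intro V.span_sum V.span_base) auto
  then obtain S y where S: "finite S" "S \<subseteq> E" "independent S" "t = (\<Sum>s\<in>S. simple_tensor scale scale s (y s))"
    by (rule bilinear_span_expansion[OF bil sE])
  obtain \<delta> where \<delta>: "\<And>s. s \<in> S \<Longrightarrow> Vector_Spaces.linear scale (*) (\<delta> s)"
    "\<And>s t. s \<in> S \<Longrightarrow> t \<in> S \<Longrightarrow> \<delta> s t = (if s = t then 1 else 0)"
    using dual_basis_exists[OF S(3)] by blast
  have y: "y s \<in> E" if s: "s \<in> S" for s
  proof -
    have "left_slice (\<delta> s) e = (\<Sum>s'\<in>S. scale (\<delta> s s') (y s'))"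
      unfolding left_slice_def by (rule expand[OF bilinear_slice(2)[OF \<delta>(1)[OF s]] S(4)])
    also have "\<dots> = (\<Sum>s'\<in>S. if s = s' then y s' else 0)"
      by (rule sum.cong) (simp_all add: \<delta>(2)[OF s])
    also have "\<dots> = y s" using S(1) s by simp
    finally show ?thesis
      using slices.stableD[OF E _ e(1), of "left_slice (\<delta> s)"] \<delta>(1)[OF s]
      by (auto simp: slices_def)
  qed
  show "t \<in> tensor_span scale scale E E"
    unfolding S(4) tensor_span_def using y S(2) by (intro V.span_sum V.span_base) auto
qed

text \<open>The comultiplication of \<open>x\<close> is a finite sum of simple tensors, and every
  slice of \<open>x\<close> lies in the span of their factors.\<close>

lemma slices_finite_dim: "\<exists>A. finite A \<and> (\<forall>T\<in>slices. T x \<in> span A)"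
proof -
  interpret V: vector_space "tensor_scale :: 'k \<Rightarrow> ('c, 'c, 'k) tensor \<Rightarrow> _"
    by (rule vector_space_tensor_scale)
  have "comult x \<in> V.span {simple_tensor scale scale a b | a b. a \<in> UNIV}"
    using comult_in[of x] by (simp add: tensor_span_def)
  then obtain S y where S: "finite S" "comult x = (\<Sum>s\<in>S. simple_tensor scale scale s (y s))"
    by (rule bilinear_span_expansion[OF bilinear_simple_tensor[OF vector_space_axioms vector_space_axioms]
          subspace_UNIV])
  have expand: "sweedler scale B x = (\<Sum>s\<in>S. B s (y s))" if B: "bilinear_map scale scale scale B" for B
  proof -
    interpret L: Vector_Spaces.linear tensor_scale scale "tensor_lift scale scale scale B"
      by (rule linear_tensor_lift[OF B])
    show ?thesis
      by (simp add: S(2) sweedler_def L.sum tensor_lift_simple[OF B])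
  qed
  have base: "s \<in> span (S \<union> y ` S)" "y s \<in> span (S \<union> y ` S)" if "s \<in> S" for s
    using that by (auto intro!: span_base)
  have "T x \<in> span (S \<union> y ` S)" if "T \<in> slices" for T
    using that unfolding slices_def
    by (auto simp: right_slice_def left_slice_def expand[OF bilinear_slice(1)] expand[OF bilinear_slice(2)] base
        intro!: span_sum span_scale)
  with S(1) show ?thesis by (intro exI[of _ "S \<union> y ` S"]) simp
qed

text \<open>The local finiteness of coalgebras. \<open>V\<close> is the sub-bimodule over the dual
  algebra generated by \<open>x\<close>: it is finite-dimensional since slicing twice needs only
  finitely many vectors, stable by \<open>slice_slice\<close>, and contains \<open>x\<close> by the
  counit.\<close>

lemma stable_superset_single: "\<exists>V. slices.stable V \<and> x \<in> V"
proof -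
  define V where "V = span {left_slice \<phi> (right_slice \<psi> x) | \<phi> \<psi>.
    Vector_Spaces.linear scale (*) \<phi> \<and> Vector_Spaces.linear scale (*) \<psi>}"
  obtain A where A: "finite A" "\<And>T. T \<in> slices \<Longrightarrow> T x \<in> span A"
    using slices_finite_dim[of x] by auto
  have "\<exists>Q. \<forall>a. finite (Q a) \<and> (\<forall>T\<in>slices. T a \<in> span (Q a))"
    by (rule choice) (rule allI slices_finite_dim)+
  then obtain Q where Q: "\<And>a. finite (Q a)" "\<And>a T. T \<in> slices \<Longrightarrow> T a \<in> span (Q a)"
    by auto
  let ?U = "span (\<Union> (Q ` A))"
  have in_U: "left_slice \<phi> z \<in> ?U" if \<phi>: "Vector_Spaces.linear scale (*) \<phi>" and z: "z \<in> span A" for \<phi> z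
  proof -
    interpret L: Vector_Spaces.linear scale scale "left_slice \<phi>" by (rule slice_linear[OF \<phi>])
    have "left_slice \<phi> a \<in> ?U" if "a \<in> A" for a
      using Q(2)[of "left_slice \<phi>" a] \<phi> that span_mono[of "Q a" "\<Union> (Q ` A)"]
      by (auto simp: slices_def)
    then have "span (left_slice \<phi> ` A) \<subseteq> ?U"
      by (intro span_minimal) auto
    with z show ?thesis by (auto simp: L.span_image)
  qed
  have "V \<subseteq> ?U"
    unfolding V_def using A(2) by (intro span_minimal) (auto simp: slices_def intro!: in_U)
  then have fin: "fin_dim_subspace scale V"
    using A(1) Q(1) by (intro fin_dim_subspace_subset[OF fin_dim_subspace_span[of "\<Union> (Q ` A)"]])
      (auto simp: V_def)
  have gen: "left_slice \<phi> (right_slice \<psi> x) \<in> V"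
    if "Vector_Spaces.linear scale (*) \<phi>" "Vector_Spaces.linear scale (*) \<psi>" for \<phi> \<psi>
    unfolding V_def using that by (intro span_base) blast
  have "T ` V \<subseteq> V" if T: "T \<in> slices" for T
  proof -
    interpret T: Vector_Spaces.linear scale scale T by (rule slices.ops_linear[OF T])
    have "T (left_slice \<phi> (right_slice \<psi> x)) \<in> V"
      if \<phi>: "Vector_Spaces.linear scale (*) \<phi>" and \<psi>: "Vector_Spaces.linear scale (*) \<psi>" for \<phi> \<psi>
    proof -
      from T obtain \<chi> where \<chi>: "Vector_Spaces.linear scale (*) \<chi>" and
        "T = right_slice \<chi> \<or> T = left_slice \<chi>" by (auto simp: slices_def)
      from this(2) show ?thesis
      proof
        assume "T = right_slice \<chi>"
        then have "T (left_slice \<phi> (right_slice \<psi> x)) =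
            left_slice \<phi> (right_slice (sweedler (*) (\<lambda>a b. \<chi> a * \<psi> b)) x)"
          by (simp add: slice_slice(3)[OF \<chi> \<phi>] slice_slice(1)[OF \<chi> \<psi>])
        then show ?thesis
          using gen[OF \<phi> sweedler_linear[OF bilinear_functionals[OF \<chi> \<psi>]]] by simp
      next
        assume "T = left_slice \<chi>"
        then have "T (left_slice \<phi> (right_slice \<psi> x)) =
            left_slice (sweedler (*) (\<lambda>a b. \<phi> a * \<chi> b)) (right_slice \<psi> x)"
          by (simp add: slice_slice(2)[OF \<chi> \<phi>])
        then show ?thesis
          using gen[OF sweedler_linear[OF bilinear_functionals[OF \<phi> \<chi>]] \<psi>] by simp
      qed
    qed
    then have "span (T ` {left_slice \<phi> (right_slice \<psi> x) | \<phi> \<psi>.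
        Vector_Spaces.linear scale (*) \<phi> \<and> Vector_Spaces.linear scale (*) \<psi>}) \<subseteq> V"
      by (intro span_minimal) (auto simp: fin_dim_subspaceD[OF fin])
    then show ?thesis unfolding V_def by (simp add: T.span_image)
  qed
  with fin have "slices.stable V" by (simp add: slices.stable_def)
  moreover have "x \<in> V" using gen[OF counit_linear counit_linear] by (simp add: slice_counit)
  ultimately show ?thesis by blast
qed

lemma stable_superset:
  assumes "fin_dim_subspace scale X"
  shows "\<exists>V. slices.stable V \<and> X \<subseteq> V"
proof -
  from assms obtain G where G: "finite G" "span G = X" by (auto simp: fin_dim_subspace_def)
  have "\<exists>V. slices.stable V \<and> G \<subseteq> V"
    using G(1)
  proof (induction G)
    case empty
    show ?case using slices.stable_zero by blast
  next
    case (insert x G)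
    then obtain V where V: "slices.stable V" "G \<subseteq> V" by blast
    obtain W where W: "slices.stable W" "x \<in> W" using stable_superset_single by blast
    have "insert x G \<subseteq> {a + b | a b. a \<in> V \<and> b \<in> W}"
    proof
      fix z assume "z \<in> insert x G"
      then have "z \<in> V \<or> z \<in> W" using V W by blast
      then have "z = z + 0 \<and> z \<in> V \<and> 0 \<in> W \<or> z = 0 + z \<and> 0 \<in> V \<and> z \<in> W"
        using subspace_0[OF slices.stable_subspace[OF V(1)]] subspace_0[OF slices.stable_subspace[OF W(1)]]
        by simp
      then show "z \<in> {a + b | a b. a \<in> V \<and> b \<in> W}" by blast
    qed
    with slices.stable_sums[OF V(1) W(1)] show ?case by blast
  qed
  then obtain V where V: "slices.stable V" "G \<subseteq> V" by blast
  then have "X \<subseteq> V" using G(2) span_minimal[OF V(2) slices.stable_subspace[OF V(1)]] by simp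
  with V show ?thesis by blast
qed

end

section \<open>Structure constants\<close>

context coalgebra
begin

definition structure_constants :: "'c set \<Rightarrow> ('c \<Rightarrow> 'c \<Rightarrow> 'c \<Rightarrow> 'k) \<Rightarrow> bool" where
  "structure_constants I \<alpha> \<longleftrightarrow>
     (\<forall>i\<in>I. comult i = (\<Sum>j\<in>I. \<Sum>k\<in>I. tensor_scale (\<alpha> i j k) (simple_tensor scale scale j k)))"

lemma structure_constants_exist:
  assumes I: "finite I" and sub: "subcoalgebra (span I)"
  shows "\<exists>\<alpha>. structure_constants I \<alpha>"
proof -
  interpret V: vector_space "tensor_scale :: 'k \<Rightarrow> ('c, 'c, 'k) tensor \<Rightarrow> _"
    by (rule vector_space_tensor_scale)
  let ?st = "simple_tensor scale scale"
  note bil = bilinear_mapD(4-7)[OF bilinear_simple_tensor[OF vector_space_axioms vector_space_axioms]]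
  have st_zero: "?st 0 b = 0" "?st a 0 = 0" for a b
    using bil(1)[of 0 0 b] bil(2)[of a 0 0] by simp_all
  have st_sum: "?st (sum f T) b = (\<Sum>i\<in>T. ?st (f i) b)" "?st a (sum f T) = (\<Sum>i\<in>T. ?st a (f i))" for f T a b
    by (induction T rule: infinite_finite_induct) (simp_all add: st_zero bil(1,2))
  have "\<exists>\<beta>. t = (\<Sum>j\<in>I. \<Sum>k\<in>I. tensor_scale (\<beta> j k) (?st j k))"
    if "t \<in> tensor_span scale scale (span I) (span I)" for t
    using that unfolding tensor_span_def
  proof (induction rule: V.span_induct_alt)
    case base
    show ?case by (intro exI[of _ "\<lambda>_ _. 0"]) simp
  next
    case (step c x t)
    then obtain a b \<beta> where ab: "x = ?st a b" "a \<in> span I" "b \<in> span I"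
      and t: "t = (\<Sum>j\<in>I. \<Sum>k\<in>I. tensor_scale (\<beta> j k) (?st j k))" by blast
    obtain u where u: "a = (\<Sum>j\<in>I. scale (u j) j)" using ab(2) span_finite[OF I] by auto
    obtain w where w: "b = (\<Sum>k\<in>I. scale (w k) k)" using ab(3) span_finite[OF I] by auto
    have "tensor_scale c x = (\<Sum>j\<in>I. \<Sum>k\<in>I. tensor_scale (c * (u j * w k)) (?st j k))"
      unfolding ab(1) u w st_sum
      by (simp add: bil V.scale_sum_right mult.commute mult.left_commute) (rule sum.swap)
    then have "tensor_scale c x + t =
        (\<Sum>j\<in>I. \<Sum>k\<in>I. tensor_scale (c * (u j * w k) + \<beta> j k) (?st j k))"
      by (simp add: t sum.distrib V.scale_left_distrib)
    then show ?case by (rule exI[of _ "\<lambda>j k. c * (u j * w k) + \<beta> j k"])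
  qed
  moreover have "comult i \<in> tensor_span scale scale (span I) (span I)" if "i \<in> I" for i
    using sub that span_base[of i I] unfolding subcoalgebra_def by blast
  ultimately have "\<forall>i\<in>I. \<exists>\<beta>. comult i = (\<Sum>j\<in>I. \<Sum>k\<in>I. tensor_scale (\<beta> j k) (?st j k))" by blast
  then show ?thesis unfolding structure_constants_def by (rule bchoice)
qed

lemma sweedler_expand:
  assumes "structure_constants I \<alpha>" "i \<in> I" and B: "bilinear_map scale scale s B"
  shows "sweedler s B i = (\<Sum>j\<in>I. \<Sum>k\<in>I. s (\<alpha> i j k) (B j k))"
proof -
  interpret L: Vector_Spaces.linear tensor_scale s "tensor_lift scale scale s B"
    by (rule linear_tensor_lift[OF B])
  show ?thesis
    using assms(1,2) by (simp add: sweedler_def structure_constants_def L.sum L.scale tensor_lift_simple[OF B])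
qed

text \<open>Dual functionals read off the constants, so each coalgebra axiom becomes an identity for
  \<open>\<alpha>\<close> once it is tested on them.\<close>

lemma structure_constants_coefficient:
  assumes "structure_constants I \<alpha>" "finite I" "i \<in> I" "j \<in> I" "k \<in> I"
    and \<delta>: "\<And>s. s \<in> I \<Longrightarrow> Vector_Spaces.linear scale (*) (\<delta> s)"
      "\<And>s t. s \<in> I \<Longrightarrow> t \<in> I \<Longrightarrow> \<delta> s t = (if s = t then 1 else 0)"
  shows "sweedler (*) (\<lambda>a b. \<delta> j a * \<delta> k b) i = \<alpha> i j k"
proof -
  have "sweedler (*) (\<lambda>a b. \<delta> j a * \<delta> k b) i = (\<Sum>j'\<in>I. \<Sum>k'\<in>I. \<alpha> i j' k' * (\<delta> j j' * \<delta> k k'))"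
    by (rule sweedler_expand[OF assms(1,3) bilinear_functionals[OF \<delta>(1)[OF assms(4)] \<delta>(1)[OF assms(5)]]])
  also have "\<dots> = (\<Sum>j'\<in>I. if j = j' then \<Sum>k'\<in>I. if k = k' then \<alpha> i j' k' else 0 else 0)"
    using assms(4,5) by (intro sum.cong) (auto simp: \<delta>(2) intro!: sum.cong)
  also have "\<dots> = \<alpha> i j k" using assms(2,4,5) by simp
  finally show ?thesis .
qed

text \<open>Coassociativity tested on the trilinear form given by \<open>\<delta> l\<close>,
  \<open>\<delta> m\<close> and \<open>\<delta> k\<close>.\<close>

lemma structure_constants_coassoc:
  assumes str: "structure_constants I \<alpha>" and I: "finite I" "independent I"
    and i: "i \<in> I" and k: "k \<in> I" and l: "l \<in> I" and m: "m \<in> I"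
  shows "(\<Sum>q\<in>I. \<alpha> i q k * \<alpha> q l m) = (\<Sum>q\<in>I. \<alpha> i l q * \<alpha> q m k)"
proof -
  obtain \<delta> where \<delta>: "\<And>s. s \<in> I \<Longrightarrow> Vector_Spaces.linear scale (*) (\<delta> s)"
    "\<And>s t. s \<in> I \<Longrightarrow> t \<in> I \<Longrightarrow> \<delta> s t = (if s = t then 1 else 0)"
    using dual_basis_exists[OF I(2)] by blast
  note lin = linearD'(3,4)[OF \<delta>(1)]
  note coeff = structure_constants_coefficient[OF str I(1) _ _ _ \<delta>]
  define T where "T a b y = \<delta> l a * \<delta> m b * \<delta> k y" for a b y
  have T12: "bilinear_map scale scale (*) (\<lambda>a b. T a b y)" for y
    using k l m by (intro bilinear_mapI vector_space_axioms vector_space_field)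
      (simp_all add: T_def lin algebra_simps)
  have T23: "bilinear_map scale scale (*) (T x)" for x
    using k l m by (intro bilinear_mapI vector_space_axioms vector_space_field)
      (simp_all add: T_def lin algebra_simps)
  have mul: "Vector_Spaces.linear (*) (*) (\<lambda>x. c * x)" "Vector_Spaces.linear (*) (*) (\<lambda>x. x * c)" for c :: 'k
    by (intro linearI' vector_space_field; simp add: algebra_simps)+
  have lm: "bilinear_map scale scale (*) (\<lambda>a b. \<delta> l a * \<delta> m b)"
    and mk: "bilinear_map scale scale (*) (\<lambda>a b. \<delta> m a * \<delta> k b)"
    by (intro bilinear_functionals \<delta> k l m)+
  have inner1: "sweedler (*) (\<lambda>a b. T a b y) x = sweedler (*) (\<lambda>a b. \<delta> l a * \<delta> m b) x * \<delta> k y" for x y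
    unfolding T_def by (rule linear_sweedler[OF mul(2) lm, symmetric])
  have inner2: "sweedler (*) (T x) y = \<delta> l x * sweedler (*) (\<lambda>a b. \<delta> m a * \<delta> k b) y" for x y
    unfolding T_def by (simp add: linear_sweedler[OF mul(1) mk] mult.assoc)
  have B1: "bilinear_map scale scale (*) (\<lambda>x y. sweedler (*) (\<lambda>a b. \<delta> l a * \<delta> m b) x * \<delta> k y)"
    by (intro bilinear_functionals sweedler_linear lm \<delta> k)
  have B2: "bilinear_map scale scale (*) (\<lambda>x y. \<delta> l x * sweedler (*) (\<lambda>a b. \<delta> m a * \<delta> k b) y)"
    by (intro bilinear_functionals sweedler_linear mk \<delta> l)
  have "(\<Sum>q\<in>I. \<alpha> i q k * \<alpha> q l m) =
      (\<Sum>x\<in>I. \<Sum>y\<in>I. \<alpha> i x y * (sweedler (*) (\<lambda>a b. \<delta> l a * \<delta> m b) x * \<delta> k y))"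
  proof (rule sum.cong)
    fix x assume x: "x \<in> I"
    have "(\<Sum>y\<in>I. \<alpha> i x y * (sweedler (*) (\<lambda>a b. \<delta> l a * \<delta> m b) x * \<delta> k y)) =
        (\<Sum>y\<in>I. if k = y then \<alpha> i x y * \<alpha> x l m else 0)"
      using k l m x by (intro sum.cong) (simp_all add: \<delta>(2) coeff)
    also have "\<dots> = \<alpha> i x k * \<alpha> x l m" using k I(1) by simp
    finally show "\<alpha> i x k * \<alpha> x l m =
      (\<Sum>y\<in>I. \<alpha> i x y * (sweedler (*) (\<lambda>a b. \<delta> l a * \<delta> m b) x * \<delta> k y))" by simp
  qed simp
  also have "\<dots> = sweedler (*) (\<lambda>x y. sweedler (*) (\<lambda>a b. T a b y) x) i"
    unfolding inner1 by (rule sweedler_expand[OF str i B1, symmetric])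
  also have "\<dots> = sweedler (*) (\<lambda>x y. sweedler (*) (T x) y) i"
    by (rule sweedler_coassoc[OF T12 T23])
  also have "\<dots> = (\<Sum>x\<in>I. \<Sum>y\<in>I. \<alpha> i x y * (\<delta> l x * sweedler (*) (\<lambda>a b. \<delta> m a * \<delta> k b) y))"
    unfolding inner2 by (rule sweedler_expand[OF str i B2])
  also have "\<dots> = (\<Sum>x\<in>I. if l = x then \<Sum>y\<in>I. \<alpha> i x y * \<alpha> y m k else 0)"
    using k l m by (intro sum.cong) (auto simp: \<delta>(2) coeff intro!: sum.cong)
  also have "\<dots> = (\<Sum>q\<in>I. \<alpha> i l q * \<alpha> q m k)" using l I(1) by simp
  finally show ?thesis .
qed

text \<open>Expansion of \<open>\<delta> k (left_slice counit i)\<close>, which equals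
  \<open>\<delta> k i\<close>.\<close>

lemma structure_constants_counit:
  assumes str: "structure_constants I \<alpha>" and I: "finite I" "independent I"
    and i: "i \<in> I" and k: "k \<in> I"
  shows "(\<Sum>j\<in>I. \<alpha> i j k * counit j) = (if i = k then 1 else 0)"
proof -
  obtain \<delta> where \<delta>: "\<And>s. s \<in> I \<Longrightarrow> Vector_Spaces.linear scale (*) (\<delta> s)"
    "\<And>s t. s \<in> I \<Longrightarrow> t \<in> I \<Longrightarrow> \<delta> s t = (if s = t then 1 else 0)"
    using dual_basis_exists[OF I(2)] by blast
  have "(if i = k then 1 else 0) = \<delta> k (left_slice counit i)"
    using \<delta>(2)[OF k i] by (simp add: slice_counit)
  also have "\<dots> = sweedler (*) (\<lambda>a b. counit a * \<delta> k b) i"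
    unfolding left_slice_def
    by (simp add: linear_sweedler[OF \<delta>(1)[OF k] bilinear_slice(2)[OF counit_linear]] linearD'(4)[OF \<delta>(1)[OF k]])
  also have "\<dots> = (\<Sum>j\<in>I. \<Sum>k'\<in>I. \<alpha> i j k' * (counit j * \<delta> k k'))"
    by (rule sweedler_expand[OF str i bilinear_functionals[OF counit_linear \<delta>(1)[OF k]]])
  also have "\<dots> = (\<Sum>j\<in>I. \<Sum>k'\<in>I. if k = k' then \<alpha> i j k' * counit j else 0)"
    using k by (intro sum.cong) (auto simp: \<delta>(2))
  also have "\<dots> = (\<Sum>j\<in>I. \<alpha> i j k * counit j)" using k I(1) by simp
  finally show ?thesis by simp
qed

lemma structure_constants_commute:
  assumes str: "structure_constants I \<alpha>" and I: "finite I" "independent I"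
    and comm: "\<And>x. tensor_swap scale scale (comult x) = comult x"
    and i: "i \<in> I" and j: "j \<in> I" and k: "k \<in> I"
  shows "\<alpha> i j k = \<alpha> i k j"
proof -
  obtain \<delta> where \<delta>: "\<And>s. s \<in> I \<Longrightarrow> Vector_Spaces.linear scale (*) (\<delta> s)"
    "\<And>s t. s \<in> I \<Longrightarrow> t \<in> I \<Longrightarrow> \<delta> s t = (if s = t then 1 else 0)"
    using dual_basis_exists[OF I(2)] by blast
  note coeff = structure_constants_coefficient[OF str I(1) _ _ _ \<delta>]
  note jk = bilinear_functionals[OF \<delta>(1)[OF j] \<delta>(1)[OF k]]
    and kj = bilinear_functionals[OF \<delta>(1)[OF k] \<delta>(1)[OF j]]
  note swap = linear_tensor_swap[OF vector_space_axioms vector_space_axioms]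
  have "\<alpha> i j k = tensor_lift scale scale (*) (\<lambda>a b. \<delta> j a * \<delta> k b) (tensor_swap scale scale (comult i))"
    using coeff[OF i j k] by (simp add: sweedler_def comm)
  also have "\<dots> = tensor_lift scale scale (*) (\<lambda>a b. \<delta> k a * \<delta> j b) (comult i)"
  proof (rule tensor_lift_unique[OF kj _ _ comult_in, symmetric])
    show "Vector_Spaces.linear tensor_scale (*)
        (\<lambda>t. tensor_lift scale scale (*) (\<lambda>a b. \<delta> j a * \<delta> k b) (tensor_swap scale scale t))"
      by (intro linearI' vector_space_tensor_scale vector_space_field)
        (simp_all add: linearD'(3,4)[OF swap] linearD'(3,4)[OF linear_tensor_lift[OF jk]])
  qed (simp add: tensor_swap_simple[OF vector_space_axioms vector_space_axioms] tensor_lift_simple[OF jk] mult.commute)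
  also have "\<dots> = \<alpha> i k j" using coeff[OF i k j] by (simp add: sweedler_def)
  finally show ?thesis .
qed

end

section \<open>The twist by a finite-dimensional subcoalgebra\<close>

text \<open>\<open>I\<close> is a basis of a finite-dimensional subcoalgebra of the Hopf algebra, so
  linear maps from it to the module are tuples indexed by \<open>I\<close>.\<close>

locale based_module_coalgebra =
  H: cocommutative_hopf_algebra scaleH comultH counitH antipode +
  module_coalgebra scaleH comultH counitH scaleM comultM counitM act
  for scaleH :: "'k::field \<Rightarrow> 'h::ring_1 \<Rightarrow> 'h"
    and comultH :: "'h \<Rightarrow> ('h, 'h, 'k) tensor"
    and counitH :: "'h \<Rightarrow> 'k"
    and antipode :: "'h \<Rightarrow> 'h"
    and scaleM :: "'k \<Rightarrow> 'm::ab_group_add \<Rightarrow> 'm"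
    and comultM :: "'m \<Rightarrow> ('m, 'm, 'k) tensor"
    and counitM :: "'m \<Rightarrow> 'k"
    and act :: "'h \<Rightarrow> 'm \<Rightarrow> 'm" +
  fixes I :: "'h set" and \<alpha> :: "'h \<Rightarrow> 'h \<Rightarrow> 'h \<Rightarrow> 'k"
  assumes finite_I: "finite I" and independent_I: "H.independent I"
    and constants: "H.structure_constants I \<alpha>"
begin

sublocale tuples: operator_tuples scaleM M.slices I
  by (intro operator_tuples.intro operator_tuples_axioms.intro M.slices.operator_space_axioms finite_I)

text \<open>Sweedler's \<open>F(i\<^sub>(\<^sub>1\<^sub>), i\<^sub>(\<^sub>2\<^sub>))\<close> for \<open>F\<close> given by its values on pairs of basis elements.\<close>

definition conv :: "'h \<Rightarrow> ('h \<Rightarrow> 'h \<Rightarrow> 'm) \<Rightarrow> 'm" where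
  "conv i F = (\<Sum>j\<in>I. \<Sum>k\<in>I. scaleM (\<alpha> i j k) (F j k))"

lemma conv_cong: "(\<And>j k. j \<in> I \<Longrightarrow> k \<in> I \<Longrightarrow> F j k = G j k) \<Longrightarrow> conv i F = conv i G"
  unfolding conv_def by (intro sum.cong) auto

lemma conv_coassoc:
  assumes "i \<in> I"
  shows "conv i (\<lambda>q k. conv q (\<lambda>l m. F l m k)) = conv i (\<lambda>l q. conv q (\<lambda>m k. F l m k))"
proof -
  have "conv i (\<lambda>q k. conv q (\<lambda>l m. F l m k)) =
      (\<Sum>q\<in>I. \<Sum>k\<in>I. \<Sum>l\<in>I. \<Sum>m\<in>I. scaleM (\<alpha> i q k * \<alpha> q l m) (F l m k))"
    by (simp add: conv_def M.scale_sum_right)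
  \<comment> \<open>The sum over \<open>q\<close> is moved innermost, where the relation between the
    structure constants applies, and is moved outwards again afterwards.\<close>
  also have "\<dots> = (\<Sum>k\<in>I. \<Sum>l\<in>I. \<Sum>m\<in>I. \<Sum>q\<in>I. scaleM (\<alpha> i q k * \<alpha> q l m) (F l m k))"
    by (rule trans[OF sum.swap], rule sum.cong[OF refl], rule trans[OF sum.swap],
        rule sum.cong[OF refl], rule sum.swap)
  also have "\<dots> = (\<Sum>k\<in>I. \<Sum>l\<in>I. \<Sum>m\<in>I. \<Sum>q\<in>I. scaleM (\<alpha> i l q * \<alpha> q m k) (F l m k))"
    by (rule sum.cong[OF refl], rule sum.cong[OF refl], rule sum.cong[OF refl])
      (simp add: M.scale_sum_left[symmetric] assms
        H.structure_constants_coassoc[OF constants finite_I independent_I])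
  also have "\<dots> = (\<Sum>l\<in>I. \<Sum>k\<in>I. \<Sum>m\<in>I. \<Sum>q\<in>I. scaleM (\<alpha> i l q * \<alpha> q m k) (F l m k))"
    by (rule sum.swap)
  also have "\<dots> = (\<Sum>l\<in>I. \<Sum>k\<in>I. \<Sum>q\<in>I. \<Sum>m\<in>I. scaleM (\<alpha> i l q * \<alpha> q m k) (F l m k))"
    by (rule sum.cong[OF refl], rule sum.cong[OF refl], rule sum.swap)
  also have "\<dots> = (\<Sum>l\<in>I. \<Sum>q\<in>I. \<Sum>m\<in>I. \<Sum>k\<in>I. scaleM (\<alpha> i l q * \<alpha> q m k) (F l m k))"
    by (rule sum.cong[OF refl], rule trans[OF sum.swap], rule sum.cong[OF refl], rule sum.swap)
  also have "\<dots> = conv i (\<lambda>l q. conv q (\<lambda>m k. F l m k))"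
    by (simp add: conv_def M.scale_sum_right)
  finally show ?thesis .
qed

lemma conv_commute:
  assumes "i \<in> I"
  shows "conv i F = conv i (\<lambda>j k. F k j)"
proof -
  have "conv i F = (\<Sum>j\<in>I. \<Sum>k\<in>I. scaleM (\<alpha> i k j) (F j k))"
    unfolding conv_def using assms
      H.structure_constants_commute[OF constants finite_I independent_I H.cocommutative]
    by (intro sum.cong refl) simp
  also have "\<dots> = conv i (\<lambda>j k. F k j)"
    unfolding conv_def by (rule sum.swap)
  finally show ?thesis .
qed

lemma linear_conv:
  assumes "Vector_Spaces.linear scaleM scaleM f"
  shows "f (conv i F) = conv i (\<lambda>j k. f (F j k))"
proof -
  interpret f: Vector_Spaces.linear scaleM scaleM f by (rule assms)
  show ?thesis by (simp add: conv_def f.sum f.scale)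
qed

lemma conv_counit:
  assumes "i \<in> I"
  shows "conv i (\<lambda>j k. scaleM (counitH j) (G k)) = G i"
proof -
  have "conv i (\<lambda>j k. scaleM (counitH j) (G k)) =
      (\<Sum>k\<in>I. \<Sum>j\<in>I. scaleM (\<alpha> i j k * counitH j) (G k))"
    unfolding conv_def by (simp, rule sum.swap)
  also have "\<dots> = (\<Sum>k\<in>I. if i = k then G k else 0)"
    by (intro sum.cong refl) (simp add: M.scale_sum_left[symmetric] assms
        H.structure_constants_counit[OF constants finite_I independent_I])
  also have "\<dots> = G i" using assms finite_I by simp
  finally show ?thesis .
qed

lemma act_linear:
  "Vector_Spaces.linear scaleM scaleM (act h)" "Vector_Spaces.linear scaleH scaleM (\<lambda>h. act h m)"
  using act_bilinear by (auto simp: bilinear_map_def)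

text \<open>The identity S(t_(1)) t_(2) = \<epsilon>(t) 1 under an arbitrary linear
  \<open>Z\<close>, so that it can be used both for elements acting on a vector and for elements
  acting inside the functional of a slice.\<close>

lemma conv_antipode:
  assumes "t \<in> I" and Z: "Vector_Spaces.linear scaleH scaleM Z"
  shows "conv t (\<lambda>p m. Z (antipode p * m)) = scaleM (counitH t) (Z 1)"
proof -
  interpret Z: Vector_Spaces.linear scaleH scaleM Z by (rule Z)
  define i where "i = (id :: 'h \<Rightarrow> 'h)"
  have i: "i x = x" for x by (simp add: i_def)
  have id: "Vector_Spaces.linear scaleH scaleH i"
    by (intro linearI' H.vector_space_axioms) (simp_all add: i)
  have tm: "tensor_map scaleH scaleH scaleH scaleH antipode i (simple_tensor scaleH scaleH a b) =
      simple_tensor scaleH scaleH (antipode a) b" for a b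
    unfolding tensor_map_simple[OF H.antipode_linear id] i by (rule refl)
  note mb = bilinear_mapD(4-7)[OF H.mult_bilinear]
  note S = linearD'(3,4)[OF H.antipode_linear]
  have B: "bilinear_map scaleH scaleH scaleH (\<lambda>a b. antipode a * b)"
    by (intro bilinear_mapI H.vector_space_axioms) (simp_all add: S mb)
  have "tensor_lift scaleH scaleH scaleH (\<lambda>a b. antipode a * b) (comultH t) =
    tensor_lift scaleH scaleH scaleH (*) (tensor_map scaleH scaleH scaleH scaleH antipode i (comultH t))"
    by (rule tensor_lift_unique[OF B _ _ H.comult_in])
      (simp_all add: tm tensor_lift_simple[OF H.mult_bilinear]
        Vector_Spaces.linear_compose[OF linear_tensor_map[OF H.antipode_linear id]
          linear_tensor_lift[OF H.mult_bilinear], unfolded o_def])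
  then have "H.sweedler scaleH (\<lambda>a b. antipode a * b) t = scaleH (counitH t) 1"
    by (simp add: H.sweedler_def H.antipode_left[folded i_def])
  then have "Z (scaleH (counitH t) 1) =
      Z (\<Sum>j\<in>I. \<Sum>k\<in>I. scaleH (\<alpha> t j k) (antipode j * k))"
    by (simp add: H.sweedler_expand[OF constants assms(1) B])
  then show ?thesis by (simp add: conv_def Z.sum Z.scale)
qed

lemma sweedler_act:
  assumes i: "i \<in> I" and B: "bilinear_map scaleM scaleM scaleM B"
  shows "M.sweedler scaleM B (act i m) = conv i (\<lambda>j k. M.sweedler scaleM (\<lambda>a b. B (act j a) (act k b)) m)"
proof -
  note ta = bilinear_tensor_action[OF act_bilinear]
  interpret A: Vector_Spaces.linear tensor_scale tensor_scale "\<lambda>t. tensor_action scaleH scaleM act t (comultM m)"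
    using ta by (simp add: bilinear_map_def)
  interpret L: Vector_Spaces.linear tensor_scale scaleM "tensor_lift scaleM scaleM scaleM B"
    by (rule linear_tensor_lift[OF B])
  note b = bilinear_mapD(4-7)[OF B]
  have "tensor_lift scaleM scaleM scaleM B
      (tensor_action scaleH scaleM act (simple_tensor scaleH scaleH j k) (comultM m)) =
      M.sweedler scaleM (\<lambda>a b. B (act j a) (act k b)) m" for j k
    unfolding M.sweedler_def
  proof (rule tensor_lift_unique[OF _ _ _ M.comult_in, symmetric])
    note aj = linearD'(3,4)[OF act_linear(1)]
    show "bilinear_map scaleM scaleM scaleM (\<lambda>a b. B (act j a) (act k b))"
      by (intro bilinear_mapI M.vector_space_axioms) (simp_all add: aj b)
    show "Vector_Spaces.linear tensor_scale scaleM (\<lambda>t. tensor_lift scaleM scaleM scaleM B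
        (tensor_action scaleH scaleM act (simple_tensor scaleH scaleH j k) t))"
      by (intro linearI' vector_space_tensor_scale M.vector_space_axioms)
        (simp_all add: bilinear_mapD(4-7)[OF ta] L.add L.scale)
  qed (simp add: tensor_action_simple[OF act_bilinear] tensor_lift_simple[OF B])
  then show ?thesis
    using constants i
    by (simp add: M.sweedler_def[of scaleM B] comult_act H.structure_constants_def A.sum A.scale L.sum L.scale
        conv_def)
qed

text \<open>Both kinds of slices satisfy the following law; for left slices this uses cocommutativity.\<close>

definition slice_law :: "(('m \<Rightarrow> 'k) \<Rightarrow> 'm \<Rightarrow> 'm) \<Rightarrow> bool" where
  "slice_law T \<longleftrightarrow>
     (\<forall>\<phi>. Vector_Spaces.linear scaleM (*) \<phi> \<longrightarrow> Vector_Spaces.linear scaleM scaleM (T \<phi>)) \<and>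
     (\<forall>\<phi> \<psi> m. Vector_Spaces.linear scaleM (*) \<phi> \<longrightarrow> Vector_Spaces.linear scaleM (*) \<psi> \<longrightarrow>
        T (\<lambda>x. \<phi> x + \<psi> x) m = T \<phi> m + T \<psi> m) \<and>
     (\<forall>\<phi> c m. Vector_Spaces.linear scaleM (*) \<phi> \<longrightarrow> T (\<lambda>x. c * \<phi> x) m = scaleM c (T \<phi> m)) \<and>
     (\<forall>\<phi> i m. Vector_Spaces.linear scaleM (*) \<phi> \<longrightarrow> i \<in> I \<longrightarrow>
        T \<phi> (act i m) = conv i (\<lambda>j k. act j (T (\<lambda>x. \<phi> (act k x)) m)))"

lemma linear_functional_act:
  "Vector_Spaces.linear scaleM (*) \<phi> \<Longrightarrow> Vector_Spaces.linear scaleM (*) (\<lambda>x. \<phi> (act h x))"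
  using Vector_Spaces.linear_compose[OF act_linear(1)] by (simp add: o_def)

lemma slice_law_slices: "slice_law M.right_slice" "slice_law M.left_slice"
proof -
  have "M.right_slice \<phi> (act i m) = conv i (\<lambda>j k. act j (M.right_slice (\<lambda>x. \<phi> (act k x)) m))"
    if \<phi>: "Vector_Spaces.linear scaleM (*) \<phi>" and i: "i \<in> I" for \<phi> i m
    unfolding M.right_slice_def sweedler_act[OF i M.bilinear_slice(1)[OF \<phi>]]
    by (simp add: M.linear_sweedler[OF act_linear(1) M.bilinear_slice(1)[OF linear_functional_act[OF \<phi>]]]
        linearD'(4)[OF act_linear(1)])
  then show "slice_law M.right_slice"
    unfolding slice_law_def
    by (simp add: M.slice_linear)
      (simp add: M.right_slice_def M.scale_left_distrib M.scale_scale[symmetric] M.sweedler_add_scale[OF M.bilinear_slice(1) M.bilinear_slice(1)]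
        del: M.scale_scale)
  \<comment> \<open>A left slice applies the functional to the first leg, so
    \<open>conv_commute\<close> exchanges the legs of \<open>i\<close> to match the law.\<close>
  have "M.left_slice \<phi> (act i m) = conv i (\<lambda>j k. act j (M.left_slice (\<lambda>x. \<phi> (act k x)) m))"
    if \<phi>: "Vector_Spaces.linear scaleM (*) \<phi>" and i: "i \<in> I" for \<phi> i m
    unfolding M.left_slice_def sweedler_act[OF i M.bilinear_slice(2)[OF \<phi>]]
    by (subst conv_commute[OF i])
      (simp add: M.linear_sweedler[OF act_linear(1) M.bilinear_slice(2)[OF linear_functional_act[OF \<phi>]]]
        linearD'(4)[OF act_linear(1)])
  then show "slice_law M.left_slice"
    unfolding slice_law_def
    by (simp add: M.slice_linear)
      (simp add: M.left_slice_def M.scale_left_distrib M.scale_scale[symmetric] M.sweedler_add_scale[OF M.bilinear_slice(2) M.bilinear_slice(2)]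
        del: M.scale_scale)
qed

text \<open>A tuple \<open>u\<close> stands for the linear map \<open>span I \<rightarrow> M\<close> with values \<open>u\<close> on the basis, and
  \<open>twist u\<close> for \<open>f \<mapsto> f\<^sub>(\<^sub>1\<^sub>) u(f\<^sub>(\<^sub>2\<^sub>))\<close>. It is inverted by the analogous map built from the antipode.\<close>

definition twist :: "('h \<Rightarrow> 'm) \<Rightarrow> 'h \<Rightarrow> 'm" where
  "twist u i = (if i \<in> I then conv i (\<lambda>j k. act j (u k)) else 0)"

section \<open>The twist: linearity, injectivity and compatibility with slices\<close>

lemma twist_linear: "Vector_Spaces.linear (fun_scale scaleM) (fun_scale scaleM) twist"
  by (intro linearI' tuples.T.vector_space_axioms)
    (simp_all add: fun_eq_iff twist_def conv_def fun_scale_apply linearD'(3,4)[OF act_linear(1)]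
      M.scale_right_distrib sum.distrib M.scale_sum_right mult.commute)

lemma twist_tuples: "twist u \<in> tuples I UNIV"
  by (simp add: tuples_def twist_def)

text \<open>In Sweedler notation u(f) = S(f_(1)) f_(2) u(f_(3)), and the right side depends only on
  the twist of \<open>u\<close>.\<close>

lemma twist_injective:
  assumes u: "u \<in> tuples I UNIV" "twist u = 0"
  shows "u = 0"
proof
  fix i
  show "u i = 0 i"
  proof (cases "i \<in> I")
    case True
    have "u i = conv i (\<lambda>t k. scaleM (counitH t) (u k))" by (rule conv_counit[OF True, symmetric])
    also have "\<dots> = conv i (\<lambda>t k. conv t (\<lambda>p j. act (antipode p) (act j (u k))))"
      by (rule conv_cong) (simp add: act_mult[symmetric] conv_antipode[OF _ act_linear(2)] act_one)
    also have "\<dots> = conv i (\<lambda>p q. conv q (\<lambda>j k. act (antipode p) (act j (u k))))"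
      by (rule conv_coassoc[OF True])
    also have "\<dots> = conv i (\<lambda>p q. act (antipode p) (twist u q))"
      by (rule conv_cong) (simp add: twist_def linear_conv[OF act_linear(1)])
    also have "\<dots> = 0"
    proof -
      interpret A: Vector_Spaces.linear scaleM scaleM "act h" for h by (rule act_linear)
      show ?thesis by (simp add: u(2) conv_def A.zero)
    qed
    finally show ?thesis by simp
  qed (use u(1) in \<open>simp add: tuples_def\<close>)
qed

lemma conv_in: "M.subspace D \<Longrightarrow> (\<And>j k. j \<in> I \<Longrightarrow> k \<in> I \<Longrightarrow> F j k \<in> D) \<Longrightarrow> conv i F \<in> D"
  unfolding conv_def by (intro M.subspace_sum M.subspace_scale)

text \<open>A slice of f_(1) u(f_(2)) along \<phi> is f_(1) applied to the slice of u(f_(3)) along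
  \<phi> composed with f_(2), by the slice law and coassociativity. It is again a twist.\<close>

lemma slice_twist:
  assumes T: "slice_law T" and \<phi>: "Vector_Spaces.linear scaleM (*) \<phi>" and i: "i \<in> I"
  shows "T \<phi> (twist u i) = twist (\<lambda>q. conv q (\<lambda>m k. T (\<lambda>x. \<phi> (act m x)) (u k))) i"
proof -
  have lin: "Vector_Spaces.linear scaleM scaleM (T \<phi>)"
    and law: "\<And>j m. j \<in> I \<Longrightarrow> T \<phi> (act j m) = conv j (\<lambda>l k. act l (T (\<lambda>x. \<phi> (act k x)) m))"
    using T \<phi> by (auto simp: slice_law_def)
  have "T \<phi> (twist u i) = conv i (\<lambda>j k. conv j (\<lambda>l m. act l (T (\<lambda>x. \<phi> (act m x)) (u k))))"
    using i by (simp add: twist_def linear_conv[OF lin]) (rule conv_cong, simp add: law)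
  also have "\<dots> = conv i (\<lambda>l q. conv q (\<lambda>m k. act l (T (\<lambda>x. \<phi> (act m x)) (u k))))"
    by (rule conv_coassoc[OF i])
  also have "\<dots> = twist (\<lambda>q. conv q (\<lambda>m k. T (\<lambda>x. \<phi> (act m x)) (u k))) i"
    using i by (simp add: twist_def linear_conv[OF act_linear(1)])
  finally show ?thesis .
qed

text \<open>The tuple found in \<open>slice_twist\<close> consists of combinations of slices of
  entries of \<open>u\<close>, so it stays in \<open>C\<close>. This is hypothesis
  \<open>st1\<close> of \<open>destabilizing_transport\<close>.\<close>

lemma slice_image_twist:
  assumes T: "slice_law T" and \<phi>: "Vector_Spaces.linear scaleM (*) \<phi>"
    and C: "M.subspace C" "\<And>\<phi> x. Vector_Spaces.linear scaleM (*) \<phi> \<Longrightarrow> x \<in> C \<Longrightarrow> T \<phi> x \<in> C"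
    and u: "u \<in> tuples I C"
  shows "T \<phi> \<circ> twist u \<in> twist ` tuples I C"
proof
  interpret L: Vector_Spaces.linear scaleM scaleM "T \<phi>" using T \<phi> by (simp add: slice_law_def)
  let ?v = "\<lambda>q. if q \<in> I then conv q (\<lambda>m k. T (\<lambda>x. \<phi> (act m x)) (u k)) else 0"
  show "?v \<in> tuples I C"
    using u C(2)[OF linear_functional_act[OF \<phi>]]
    by (auto simp: tuples_def intro!: conv_in[OF C(1)])
  show "T \<phi> \<circ> twist u = twist ?v"
  proof
    fix i
    show "(T \<phi> \<circ> twist u) i = twist ?v i"
    proof (cases "i \<in> I")
      case True
      then show ?thesis
        using slice_twist[OF T \<phi> True, of u]
        by (simp add: twist_def) (rule conv_cong, simp)
    qed (simp add: twist_def L.zero)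
  qed
qed

text \<open>In Sweedler notation: \<open>f\<^sub>(\<^sub>1\<^sub>) T\<^sub>\<phi>(u(f\<^sub>(\<^sub>2\<^sub>)))\<close> is recovered from the slices of
  \<open>w(f) = f\<^sub>(\<^sub>1\<^sub>) u(f\<^sub>(\<^sub>2\<^sub>))\<close> along \<open>\<phi> \<circ> S(f\<^sub>(\<^sub>1\<^sub>))\<close>, cocommutativity bringing \<open>S(f\<^sub>(\<^sub>1\<^sub>))\<close> next to the factor it cancels.\<close>

lemma twist_slice:
  assumes T: "slice_law T" and \<phi>: "Vector_Spaces.linear scaleM (*) \<phi>" and i: "i \<in> I"
  shows "twist (T \<phi> \<circ> u) i = conv i (\<lambda>p q. T (\<lambda>x. \<phi> (act (antipode p) x)) (twist u q))"
proof -
  have lin: "Vector_Spaces.linear scaleM scaleM (T \<psi>)"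
    and add: "\<And>\<psi>' m. Vector_Spaces.linear scaleM (*) \<psi>' \<Longrightarrow> T (\<lambda>x. \<psi> x + \<psi>' x) m = T \<psi> m + T \<psi>' m"
    and scale: "\<And>c m. T (\<lambda>x. c * \<psi> x) m = scaleM c (T \<psi> m)"
    and law: "\<And>j m. j \<in> I \<Longrightarrow> T \<psi> (act j m) = conv j (\<lambda>l k. act l (T (\<lambda>x. \<psi> (act k x)) m))"
    if "Vector_Spaces.linear scaleM (*) \<psi>" for \<psi>
    using T that by (auto simp: slice_law_def)
  note \<phi>h = linear_functional_act[OF \<phi>]
  note \<phi>hh = linear_functional_act[OF \<phi>h]
  define X where "X p l m k = act l (T (\<lambda>x. \<phi> (act (antipode p) (act m x))) (u k))" for p l m k
  \<comment> \<open>Inside the functional the antipode meets the factor \<open>m\<close>, and the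
    product collapses to the counit.\<close>
  have cancel: "conv t (\<lambda>p m. X p l m k) = scaleM (counitH t) (act l (T \<phi> (u k)))" if t: "t \<in> I" for t l k
  proof -
    define Z where "Z h = act l (T (\<lambda>x. \<phi> (act h x)) (u k))" for h
    have "Vector_Spaces.linear scaleH scaleM Z"
      by (intro linearI' H.vector_space_axioms M.vector_space_axioms)
        (simp_all add: Z_def linearD'(3,4)[OF act_linear(2)] linearD'(3,4)[OF \<phi>] add[OF \<phi>h \<phi>h]
          scale[OF \<phi>h] linearD'(3,4)[OF act_linear(1)])
    from conv_antipode[OF t this] show ?thesis
      by (simp add: Z_def X_def act_mult act_one)
  qed
  \<comment> \<open>The four legs of \<open>i\<close> are \<open>p\<close>, \<open>l\<close>,
    \<open>m\<close>, \<open>k\<close> in this order: \<open>p\<close> enters the antipode,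
    \<open>l\<close> acts outside the slice, \<open>m\<close> acts inside the functional,
    \<open>k\<close> is the argument of \<open>u\<close>.\<close>
  have "conv i (\<lambda>p q. T (\<lambda>x. \<phi> (act (antipode p) x)) (twist u q)) =
      conv i (\<lambda>p q. conv q (\<lambda>j k. conv j (\<lambda>l m. X p l m k)))"
    by (rule conv_cong)
      (simp add: twist_def linear_conv[OF lin[OF \<phi>h]] X_def, rule conv_cong, simp add: law[OF \<phi>h])
  also have "\<dots> = conv i (\<lambda>p q. conv q (\<lambda>l r. conv r (\<lambda>m k. X p l m k)))"
    by (rule conv_cong) (rule conv_coassoc)
  also have "\<dots> = conv i (\<lambda>s r. conv s (\<lambda>p l. conv r (\<lambda>m k. X p l m k)))"
    by (rule conv_coassoc[OF i, symmetric])
  \<comment> \<open>Cocommutativity on the first two legs moves \<open>p\<close> past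
    \<open>l\<close>, next to \<open>m\<close>.\<close>
  also have "\<dots> = conv i (\<lambda>s r. conv s (\<lambda>l p. conv r (\<lambda>m k. X p l m k)))"
    by (rule conv_cong) (rule conv_commute)
  also have "\<dots> = conv i (\<lambda>l q. conv q (\<lambda>p r. conv r (\<lambda>m k. X p l m k)))"
    by (rule conv_coassoc[OF i])
  also have "\<dots> = conv i (\<lambda>l q. conv q (\<lambda>t k. conv t (\<lambda>p m. X p l m k)))"
    by (rule conv_cong) (rule conv_coassoc[symmetric])
  also have "\<dots> = conv i (\<lambda>l q. conv q (\<lambda>t k. scaleM (counitH t) (act l (T \<phi> (u k)))))"
    by (rule conv_cong) (rule conv_cong, rule cancel)
  also have "\<dots> = conv i (\<lambda>l q. act l (T \<phi> (u q)))"
    by (rule conv_cong) (rule conv_counit)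
  finally show ?thesis using i by (simp add: twist_def)
qed

text \<open>\<open>destabilizing_transport\<close> for the twist sends tuples over \<open>C\<close>
  to tuples over \<open>D\<close>. The vector \<open>c\<close> corresponds to the tuple
  \<epsilon>(f) c, whose twist is f c.\<close>

lemma destabilizing_act:
  assumes E: "fin_dim_subspace scaleM E" and E': "fin_dim_subspace scaleM E'"
    and EE': "\<And>i e. i \<in> I \<Longrightarrow> e \<in> E \<Longrightarrow> act i e \<in> E'"
    and C: "M.slices.destabilizing l E C" and D: "M.slices.destabilizing l E' D"
    and i: "i \<in> I" and c: "c \<in> C"
  shows "act i c \<in> D"
proof -
  have stC: "M.slices.stable C" and stD: "M.slices.stable D"
    using C D by (auto intro: M.slices.destabilizing_stable)
  note sC = M.slices.stable_subspace[OF stC] and sD = M.slices.stable_subspace[OF stD]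
  have T: "\<exists>S \<phi>. slice_law S \<and> Vector_Spaces.linear scaleM (*) \<phi> \<and> T = S \<phi> \<and>
      (\<forall>\<psi>. Vector_Spaces.linear scaleM (*) \<psi> \<longrightarrow> S \<psi> \<in> M.slices)" if "T \<in> M.slices" for T
    using that slice_law_slices unfolding M.slices_def by blast
  have "twist ` tuples I C \<subseteq> tuples I D"
  proof (rule tuples.destabilizing_transport[OF twist_linear twist_injective _ E E' _ C D])
    show "twist ` tuples I UNIV \<subseteq> tuples I UNIV" using twist_tuples by blast
    show "twist ` tuples I E \<subseteq> tuples I E'"
      using EE' by (auto simp: tuples_def twist_def intro!: conv_in[OF M.fin_dim_subspaceD[OF E']])
  next
    fix T u assume "T \<in> M.slices" and u: "u \<in> tuples I C"
    then obtain S \<phi> where S: "slice_law S" "Vector_Spaces.linear scaleM (*) \<phi>" "T = S \<phi>"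
      "\<And>\<psi>. Vector_Spaces.linear scaleM (*) \<psi> \<Longrightarrow> S \<psi> \<in> M.slices" using T by blast
    show "T \<circ> twist u \<in> twist ` tuples I C"
      unfolding S(3)
      by (rule slice_image_twist[OF S(1,2) sC _ u]) (rule M.slices.stableD[OF stC S(4)])
    assume w: "twist u \<in> tuples I D"
    have "twist (T \<circ> u) i \<in> D" if "i \<in> I" for i
      unfolding S(3) twist_slice[OF S(1,2) that]
    proof (rule conv_in[OF sD])
      fix p q assume "q \<in> I"
      with w have "twist u q \<in> D" by (simp add: tuples_def)
      then show "S (\<lambda>x. \<phi> (act (antipode p) x)) (twist u q) \<in> D"
        by (rule M.slices.stableD[OF stD S(4)[OF linear_functional_act[OF S(2)]]])
    qed
    then show "twist (T \<circ> u) \<in> tuples I D"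
      by (auto simp: tuples_def twist_def)
  qed
  note transport = this
  define u where "u k = (if k \<in> I then scaleM (counitH k) c else 0)" for k
  have "u \<in> tuples I C" using c sC by (auto simp: u_def tuples_def M.subspace_scale)
  with transport have "twist u \<in> tuples I D" by blast
  then have "twist u i \<in> D" using i by (simp add: tuples_def)
  moreover have "twist u i = act i c"
  proof -
    \<comment> \<open>The counit sits on the second leg here, while \<open>conv_counit\<close> has
      it on the first; cocommutativity exchanges them.\<close>
    have "twist u i = conv i (\<lambda>j k. scaleM (counitH k) (act j c))"
      using i by (simp add: twist_def) (rule conv_cong, simp add: u_def linearD'(4)[OF act_linear(1)])
    also have "\<dots> = act i c"
      using conv_commute[OF i, of "\<lambda>j k. scaleM (counitH k) (act j c)"] conv_counit[OF i, of "\<lambda>k. act k c"]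
      by simp
    finally show ?thesis .
  qed
  ultimately show ?thesis by simp
qed

end

section \<open>Amenability of module coalgebras\<close>

context left_module
begin

lemma act_span_subset:
  assumes "M.subspace U" "\<And>f e. f \<in> F \<Longrightarrow> e \<in> E \<Longrightarrow> act f e \<in> U"
  shows "act_span F E \<subseteq> U"
  unfolding act_span_def using assms by (intro M.span_minimal) auto

lemma act_span_mono: "F \<subseteq> F' \<Longrightarrow> act_span F E \<subseteq> act_span F' E"
  unfolding act_span_def by (rule M.span_mono) blast

lemma subspace_act_span: "M.subspace (act_span F E)"
  by (simp add: act_span_def)

lemma act_span_span_subset:
  assumes U: "M.subspace U" and "\<And>f e. f \<in> I \<Longrightarrow> e \<in> G \<Longrightarrow> act f e \<in> U"
  shows "act_span (H.span I) (M.span G) \<subseteq> U"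
proof (rule act_span_subset[OF U])
  note act = bilinear_mapD(4-7)[OF act_bilinear]
  have zero: "act 0 e = 0" "act f 0 = 0" for e f
    using act(1)[of 0 0 e] act(2)[of f 0 0] by simp_all
  fix f e assume f: "f \<in> H.span I" and e: "e \<in> M.span G"
  have gen: "act i e \<in> U" if "i \<in> I" for i
    using e
  proof (induction rule: M.span_induct_alt)
    case base
    show ?case using U by (simp add: zero M.subspace_0)
  next
    case (step c x y)
    then show ?case using U assms(2)[OF that]
      by (simp add: act M.subspace_add M.subspace_scale)
  qed
  show "act f e \<in> U"
    using f
  proof (induction rule: H.span_induct_alt)
    case base
    show ?case using U by (simp add: zero M.subspace_0)
  next
    case (step c x y)
    then show ?case using U gen
      by (simp add: act M.subspace_add M.subspace_scale)
  qed
qed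

lemma fin_dim_act_span:
  assumes "fin_dim_subspace scaleH F" "fin_dim_subspace scaleM E"
  shows "fin_dim_subspace scaleM (act_span F E)"
proof -
  obtain I G where IG: "finite I" "H.span I = F" "finite G" "M.span G = E"
    using assms by (auto simp: fin_dim_subspace_def)
  have "act_span F E \<subseteq> M.span ((\<lambda>(f, e). act f e) ` (I \<times> G))"
    unfolding IG(2,4)[symmetric]
    by (rule act_span_span_subset) (auto intro!: M.span_base)
  then show ?thesis
    using IG by (intro M.fin_dim_subspace_subset[OF M.fin_dim_subspace_span] subspace_act_span) auto
qed

text \<open>Both spaces are finite-dimensional, so the quotient dimension is a difference. The bound
  becomes a ratio of dimensions, the form needed for averaging.\<close>

lemma almost_invariant_iff:
  assumes "fin_dim_subspace scaleH F" and E: "fin_dim_subspace scaleM E"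
  shows "almost_invariant F \<epsilon> E \<longleftrightarrow>
    real (M.dim {x + y | x y. x \<in> E \<and> y \<in> act_span F E}) < (1 + \<epsilon>) * real (M.dim E)"
proof -
  let ?S = "{x + y | x y. x \<in> E \<and> y \<in> act_span F E}"
  note sE = M.fin_dim_subspaceD[OF E]
  have fS: "fin_dim_subspace scaleM ?S"
    by (intro M.fin_dim_subspace_sums E fin_dim_act_span assms)
  have sub: "E \<subseteq> ?S" using M.subspace_0[OF subspace_act_span] by force
  have "M.dim E \<le> M.dim ?S" by (rule M.fin_dim_subspace_dim_mono[OF fS sE sub])
  then show ?thesis
    unfolding almost_invariant_def M.quotient_dim_eq[OF fS sE sub]
    by (simp add: of_nat_diff algebra_simps)
qed

end

theorem theorem1:
  fixes scaleH :: "'k::field \<Rightarrow> 'h::ring_1 \<Rightarrow> 'h"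
    and comultH :: "'h \<Rightarrow> ('h, 'h, 'k) tensor"
    and counitH :: "'h \<Rightarrow> 'k"
    and antipode :: "'h \<Rightarrow> 'h"
    and scaleM :: "'k \<Rightarrow> 'm::ab_group_add \<Rightarrow> 'm"
    and comultM :: "'m \<Rightarrow> ('m, 'm, 'k) tensor"
    and counitM :: "'m \<Rightarrow> 'k"
    and act :: "'h \<Rightarrow> 'm \<Rightarrow> 'm"
  assumes "cocommutative_hopf_algebra scaleH comultH counitH antipode"
    and "module_coalgebra scaleH comultH counitH scaleM comultM counitM act"
  shows "module_coalgebra.amenable scaleH scaleM comultM act \<longleftrightarrow>
         left_module.algebraically_amenable scaleH scaleM act"
proof -
  interpret H: cocommutative_hopf_algebra scaleH comultH counitH antipode by (rule assms(1))
  interpret module_coalgebra scaleH comultH counitH scaleM comultM counitM act by (rule assms(2))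
  show ?thesis
  proof
    show "algebraically_amenable" if amenable
      using that unfolding amenable_def algebraically_amenable_def by blast
    assume alg: algebraically_amenable
    show amenable
      unfolding amenable_def
    proof (intro allI impI, elim conjE)
      fix F and \<epsilon> :: real
      assume F: "fin_dim_subspace scaleH F" and \<epsilon>: "0 < \<epsilon>"
      \<comment> \<open>The unit is put into \<open>V\<close> so that \<open>C \<subseteq> D\<close>
        will follow from \<open>act_span V C \<subseteq> D\<close>.\<close>
      obtain V where V: "H.slices.stable V" "{x + y | x y. x \<in> F \<and> y \<in> H.span {1}} \<subseteq> V"
        using H.stable_superset[OF H.fin_dim_subspace_sums[OF F H.fin_dim_subspace_span[of "{1}"]]]
        by auto
      have FV: "F \<subseteq> V" using V(2) H.span_zero by force
      have "0 + 1 \<in> V" using V(2) H.subspace_0[OF H.fin_dim_subspaceD[OF F]] H.span_base by blast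
      then have one: "1 \<in> V" by simp
      note fV = H.slices.stable_fin_dim[OF V(1)]
      obtain I where I: "I \<subseteq> V" "H.independent I" "V \<subseteq> H.span I"
        using H.maximal_independent_subset by blast
      have spI: "H.span I = V"
        using I by (metis H.slices.stable_subspace H.span_minimal V(1) subset_antisym)
      obtain G where "finite G" "H.span G = V" using fV by (auto simp: fin_dim_subspace_def)
      then have fI: "finite I" using H.independent_span_bound[of G I] I by blast
      obtain \<alpha> where \<alpha>: "H.structure_constants I \<alpha>"
        using H.structure_constants_exist[OF fI] H.stable_imp_subcoalgebra[OF V(1)] spI by auto
      interpret B: based_module_coalgebra scaleH comultH counitH antipode scaleM comultM counitM act I \<alpha>
        by unfold_locales (fact fI I \<alpha>)+
      \<comment> \<open>Algebraic amenability is applied to the subcoalgebra \<open>V\<close>, not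
        just to \<open>F\<close>, since the twist needs a subcoalgebra.\<close>
      obtain E where E: "fin_dim_subspace scaleM E" "almost_invariant V \<epsilon> E"
        using alg fV \<epsilon> unfolding algebraically_amenable_def by blast
      define E' where "E' = {x + y | x y. x \<in> E \<and> y \<in> act_span V E}"
      have E': "fin_dim_subspace scaleM E'"
        unfolding E'_def by (intro M.fin_dim_subspace_sums fin_dim_act_span E fV)
      have dimE': "real (M.dim E') < (1 + \<epsilon>) * real (M.dim E)"
        using E(2) almost_invariant_iff[OF fV E(1)] by (simp add: E'_def)
      have actE: "act i e \<in> E'" if "i \<in> I" "e \<in> E" for i e
      proof -
        have "act i e \<in> act_span V E"
          unfolding act_span_def using that I(1) by (intro M.span_base) blast
        moreover have "act i e = 0 + act i e" by simp
        ultimately show ?thesis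
          using M.subspace_0[OF M.fin_dim_subspaceD[OF E(1)]] unfolding E'_def by blast
      qed
      obtain W where W: "M.slices.stable W" "E \<subseteq> W" using M.stable_superset[OF E(1)] by blast
      \<comment> \<open>Otherwise every positive \<open>l\<close> has a pair with ratio at least
        \<open>1 + \<epsilon>\<close>, and averaging gives this ratio for \<open>E\<close> and
        \<open>E'\<close> themselves, against \<open>dimE'\<close>.\<close>
      have "\<exists>l. 0 < l \<and> (\<forall>C D. M.slices.destabilizing l E C \<longrightarrow> M.slices.destabilizing l E' D \<longrightarrow>
          real (M.dim D) < (1 + \<epsilon>) * real (M.dim C))"
      proof (rule ccontr)
        assume neg: "\<not> ?thesis"
        have "(1 + \<epsilon>) * real (M.dim E) \<le> real (M.dim E')"
        proof (rule M.slices.destabilizing_average[OF E(1) E' W])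
          fix l :: real assume "0 < l"
          with neg show "\<exists>C D. M.slices.destabilizing l E C \<and> M.slices.destabilizing l E' D \<and>
              (1 + \<epsilon>) * real (M.dim C) \<le> real (M.dim D)"
            by (meson not_le)
        qed (use \<epsilon> in simp)
        with dimE' show False by simp
      qed
      then obtain l where l: "0 < l" and
        small: "\<And>C D. M.slices.destabilizing l E C \<Longrightarrow> M.slices.destabilizing l E' D \<Longrightarrow>
          real (M.dim D) < (1 + \<epsilon>) * real (M.dim C)"
        by blast
      obtain C where C: "M.slices.destabilizing l E C"
        using M.slices.destabilizing_exists[OF E(1) l] by blast
      obtain D where D: "M.slices.destabilizing l E' D"
        using M.slices.destabilizing_exists[OF E' l] by blast
      have stC: "M.slices.stable C" and stD: "M.slices.stable D"
        using C D by (auto intro: M.slices.destabilizing_stable)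
      note fC = M.slices.stable_fin_dim[OF stC] and fD = M.slices.stable_fin_dim[OF stD]
      note sC = M.slices.stable_subspace[OF stC] and sD = M.slices.stable_subspace[OF stD]
      have "act_span (H.span I) (M.span C) \<subseteq> D"
        by (rule act_span_span_subset[OF sD]) (rule B.destabilizing_act[OF E(1) E' actE C D])
      then have VC: "act_span V C \<subseteq> D"
        by (simp only: spI M.span_eq_iff[THEN iffD2, OF sC])
      have "C \<subseteq> D"
      proof
        fix c assume "c \<in> C"
        then have "act 1 c \<in> act_span V C"
          unfolding act_span_def using one by (intro M.span_base) blast
        then show "c \<in> D" using VC by (auto simp: act_one)
      qed
      \<comment> \<open>The dimension of \<open>D\<close> is controlled by the choice of
        \<open>l\<close>, so a subspace of \<open>D\<close> containing \<open>C\<close> is only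
        slightly larger than \<open>C\<close>.\<close>
      then have "{x + y | x y. x \<in> C \<and> y \<in> act_span F C} \<subseteq> D"
        using VC act_span_mono[OF FV] sD by (auto intro!: M.subspace_add[OF sD])
      then have "M.dim {x + y | x y. x \<in> C \<and> y \<in> act_span F C} \<le> M.dim D"
        by (intro M.fin_dim_subspace_dim_mono fD M.subspace_sums sC subspace_act_span)
      then have "almost_invariant F \<epsilon> C"
        using small[OF C D] by (simp add: almost_invariant_iff[OF F fC])
      with fC M.stable_imp_subcoalgebra[OF stC]
      show "\<exists>E. fin_dim_subspace scaleM E \<and> M.subcoalgebra E \<and> almost_invariant F \<epsilon> E" by blast
    qed
  qed
qed

end
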